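(* Let $K$ be a field of characteristic different from $2$ and $3$. The finite-dimensional mock-Lie algebras over $K$ for which the Poincaré–Birkhoff–Witt theorem holds are exactly the abelian ones. That is, let $L$ be a finite-dimensional mock-Lie algebra over $K$ with basis $x_1,\dots,x_n$; then the monomials $x_{i_1}\cdots x_{i_k}$, $1\le i_1<\dots<i_k\le n$, $0\le k\le n$ (the empty monomial being $1$), form a basis of the vector space $U(L)$ if and only if $L$ is abelian.
   Context: A mock-Lie algebra over $K$ is a (not necessarily associative) $K$-algebra $L$ with bilinear multiplication $\circ$ which is commutative, $x\circ y=y\circ x$, and satisfies the Jacobi identity $(x\circ y)\circ z+(z\circ x)\circ y+(y\circ z)\circ x=0$ for all $x,y,z\in L$. It is abelian if $x\circ y=0$ for all $x,y\in L$. The universal enveloping algebra $U(L)$ is the unital associative algebra obtained as the quotient of the tensor algebra $T(L)$ by the two-sided ideal generated by all elements $\frac12(x\otimes y+y\otimes x)-x\circ y$ with $x,y\in L$. In the monomials $x_{i_1}\cdots x_{i_k}$, the $x_i$ denote the images of the basis elements in $U(L)$. "These monomials form a basis" means that, as a family indexed by the increasing sequences $i_1<\dots<i_k$, they are linearly independent and span $U(L)$. *)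

theory Defs
  imports
    "HOL-Library.Poly_Mapping"
    "HOL-Algebra.Algebraic_Closure_Type"
    "Jordan_Normal_Form.Missing_VectorSpace"
begin

text \<open>
  The space \<open>L\<close> and its field of scalars are types; the associative algebras built from \<open>L\<close> depend
  on the operations of \<open>L\<close>, so they are records of HOL-Algebra, over the scalar field
  \<open>ring_of_type_algebra\<close>.
\<close>

locale mock_lie_algebra = vector_space scale
  for scale :: "'k::field \<Rightarrow> 'l::ab_group_add \<Rightarrow> 'l"
    and mul :: "'l \<Rightarrow> 'l \<Rightarrow> 'l" +
  assumes linear_right: "Vector_Spaces.linear scale scale (\<lambda>y. mul x y)"
    and linear_left: "Vector_Spaces.linear scale scale (\<lambda>x. mul x y)"
    and commute: "mul x y = mul y x"
    and jacobi: "mul (mul x y) z + mul (mul z x) y + mul (mul y z) x = 0"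

definition abelian :: "('l \<Rightarrow> 'l \<Rightarrow> 'l::zero) \<Rightarrow> bool"
  where "abelian mul \<longleftrightarrow> (\<forall>x y. mul x y = 0)"


section \<open>Associative unital algebras and their quotients\<close>

locale assoc_algebra = module K A + A?: ring A for K (structure) and A (structure) +
  assumes smult_mult_left:
      "\<lbrakk>c \<in> carrier K; x \<in> carrier A; y \<in> carrier A\<rbrakk>
        \<Longrightarrow> (c \<odot>\<^bsub>A\<^esub> x) \<otimes>\<^bsub>A\<^esub> y = c \<odot>\<^bsub>A\<^esub> (x \<otimes>\<^bsub>A\<^esub> y)"
    and smult_mult_right:
      "\<lbrakk>c \<in> carrier K; x \<in> carrier A; y \<in> carrier A\<rbrakk>
        \<Longrightarrow> x \<otimes>\<^bsub>A\<^esub> (c \<odot>\<^bsub>A\<^esub> y) = c \<odot>\<^bsub>A\<^esub> (x \<otimes>\<^bsub>A\<^esub> y)"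

definition quotient_algebra :: "('k, 'a, 'm) module_scheme \<Rightarrow> 'a set \<Rightarrow> ('k, 'a set) module"
  where "quotient_algebra A I =
    \<lparr>carrier = carrier (A Quot I), monoid.mult = monoid.mult (A Quot I), one = one (A Quot I),
     ring.zero = ring.zero (A Quot I), add = add (A Quot I),
     module.smult = (\<lambda>c S. \<Union>x\<in>S. I +>\<^bsub>A\<^esub> (c \<odot>\<^bsub>A\<^esub> x))\<rparr>"

lemma quotient_algebra_simps:
  "carrier (quotient_algebra A I) = a_rcosets\<^bsub>A\<^esub> I"
  "monoid.mult (quotient_algebra A I) = rcoset_mult A I"
  "one (quotient_algebra A I) = I +>\<^bsub>A\<^esub> \<one>\<^bsub>A\<^esub>"
  "ring.zero (quotient_algebra A I) = I"
  "add (quotient_algebra A I) = set_add A"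
  "module.smult (quotient_algebra A I) = (\<lambda>c S. \<Union>x\<in>S. I +>\<^bsub>A\<^esub> (c \<odot>\<^bsub>A\<^esub> x))"
  by (simp_all add: quotient_algebra_def FactRing_def)

lemma (in assoc_algebra) smult_ideal:
  assumes "ideal I A" "c \<in> carrier K" "x \<in> I"
  shows "c \<odot>\<^bsub>A\<^esub> x \<in> I"
proof -
  interpret I: ideal I A by fact
  have x: "x \<in> carrier A" using assms(3) by (rule I.a_Hcarr)
  have "c \<odot>\<^bsub>A\<^esub> x = (c \<odot>\<^bsub>A\<^esub> \<one>\<^bsub>A\<^esub>) \<otimes>\<^bsub>A\<^esub> x"
    using assms(2) x by (simp add: smult_mult_left)
  also have "\<dots> \<in> I" using assms(2,3) by (intro I.I_l_closed) auto
  finally show ?thesis .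
qed

lemma (in assoc_algebra) quotient_smult:
  assumes I: "ideal I A" and c: "c \<in> carrier K" and x: "x \<in> carrier A"
  shows "c \<odot>\<^bsub>quotient_algebra A I\<^esub> (I +>\<^bsub>A\<^esub> x) = I +>\<^bsub>A\<^esub> (c \<odot>\<^bsub>A\<^esub> x)"
proof -
  interpret I: ideal I A by fact
  have "I +>\<^bsub>A\<^esub> (c \<odot>\<^bsub>A\<^esub> y) = I +>\<^bsub>A\<^esub> (c \<odot>\<^bsub>A\<^esub> x)" if y: "y \<in> I +>\<^bsub>A\<^esub> x" for y
  proof -
    from y obtain h where h: "h \<in> I" "y = h \<oplus>\<^bsub>A\<^esub> x"
      by (auto simp: a_r_coset_def r_coset_def)
    have hc: "h \<in> carrier A" using h(1) by (rule I.a_Hcarr)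
    have "c \<odot>\<^bsub>A\<^esub> y = c \<odot>\<^bsub>A\<^esub> h \<oplus>\<^bsub>A\<^esub> c \<odot>\<^bsub>A\<^esub> x"
      using h hc c x by (simp add: smult_r_distr)
    moreover have "c \<odot>\<^bsub>A\<^esub> h \<in> I" using smult_ideal I c h(1) by blast
    ultimately have "c \<odot>\<^bsub>A\<^esub> y \<in> I +>\<^bsub>A\<^esub> (c \<odot>\<^bsub>A\<^esub> x)"
      by (auto simp: a_r_coset_def r_coset_def)
    thus ?thesis
      by (rule M.a_repr_independence[OF _ smult_closed[OF c x] I.a_subgroup, symmetric])
  qed
  moreover have "I +>\<^bsub>A\<^esub> x \<noteq> {}" using I.a_rcos_self x by blast
  ultimately have "(\<Union>y\<in>I +>\<^bsub>A\<^esub> x. I +>\<^bsub>A\<^esub> (c \<odot>\<^bsub>A\<^esub> y)) = I +>\<^bsub>A\<^esub> (c \<odot>\<^bsub>A\<^esub> x)"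
    by (intro SUP_eq_const)
  thus ?thesis by (simp only: quotient_algebra_simps)
qed

lemma (in assoc_algebra) quotient_algebra_assoc_algebra:
  assumes I: "ideal I A"
  shows "assoc_algebra K (quotient_algebra A I)"
proof -
  interpret I: ideal I A by fact
  let ?Q = "quotient_algebra A I"
  interpret Q: ring "A Quot I" by (rule I.quotient_is_ring)
  have ring: "ring ?Q"
  proof (rule ringI)
    show "abelian_group ?Q"
      unfolding quotient_algebra_def
      by (rule abelian_groupI)
         (simp_all add: Q.a_assoc Q.a_comm Q.add.m_lcomm)
    show "Group.monoid ?Q"
      unfolding quotient_algebra_def by (rule monoidI) (simp_all add: Q.m_assoc)
  qed (simp_all add: quotient_algebra_def Q.l_distr Q.r_distr)
  have cos: "\<exists>x\<in>carrier A. S = I +>\<^bsub>A\<^esub> x" if "S \<in> carrier ?Q" for S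
    using that by (auto simp: quotient_algebra_simps A_RCOSETS_def' a_r_coset_def r_coset_def)
  have mem: "I +>\<^bsub>A\<^esub> x \<in> carrier ?Q" if "x \<in> carrier A" for x
    using that by (simp add: quotient_algebra_simps M.a_rcosetsI[OF I.a_subset])
  have add: "(I +>\<^bsub>A\<^esub> x) \<oplus>\<^bsub>?Q\<^esub> (I +>\<^bsub>A\<^esub> y) = I +>\<^bsub>A\<^esub> (x \<oplus>\<^bsub>A\<^esub> y)"
    if "x \<in> carrier A" "y \<in> carrier A" for x y
    using that by (simp add: quotient_algebra_simps I.a_rcos_sum)
  have mult: "(I +>\<^bsub>A\<^esub> x) \<otimes>\<^bsub>?Q\<^esub> (I +>\<^bsub>A\<^esub> y) = I +>\<^bsub>A\<^esub> (x \<otimes>\<^bsub>A\<^esub> y)"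
    if "x \<in> carrier A" "y \<in> carrier A" for x y
    using that by (simp add: quotient_algebra_simps I.rcoset_mult_add)
  note sm = quotient_smult[OF I]
  have "module K ?Q"
  proof (rule moduleI)
    show "cring K" by (rule R.is_cring)
    show "abelian_group ?Q" using ring by (rule ring.axioms)
  qed (auto dest!: cos simp: sm mem add smult_l_distr smult_r_distr smult_assoc1)
  moreover have "assoc_algebra_axioms K ?Q"
    by unfold_locales
       (auto dest!: cos simp: sm mult smult_mult_left smult_mult_right)
  ultimately show ?thesis
    using ring by (intro assoc_algebra.intro)
qed


section \<open>The tensor algebra\<close>

datatype 'a word = Word (letters: "'a list")

instantiation word :: (type) monoid_add
begin

definition zero_word :: "'a word" where "0 = Word []"

definition plus_word :: "'a word \<Rightarrow> 'a word \<Rightarrow> 'a word"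
  where "u + v = Word (letters u @ letters v)"

instance by standard (auto simp: zero_word_def plus_word_def)

end

text \<open>
  The free associative algebra on the underlying set of \<open>L\<close>: finitely supported functions on words,
  with the convolution product, i.e. the bilinear extension of concatenation.
\<close>

definition free_algebra :: "('k::field, 'l word \<Rightarrow>\<^sub>0 'k) module"
  where "free_algebra =
    \<lparr>carrier = UNIV, monoid.mult = (*), one = 1, ring.zero = 0, add = (+),
     module.smult = (\<lambda>c. Poly_Mapping.map ((*) c))\<rparr>"

lemma free_algebra_assoc_algebra:
  "assoc_algebra (ring_of_type_algebra :: 'k::field ring)
     (free_algebra :: ('k, 'l word \<Rightarrow>\<^sub>0 'k) module)"
proof -
  have comm: "Poly_Mapping.single 0 c * p = p * Poly_Mapping.single 0 c" for c :: 'k and p :: "'l word \<Rightarrow>\<^sub>0 'k"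
  proof (induction p rule: update_induct)
    case (update p w b)
    have "Poly_Mapping.update w b p = p + Poly_Mapping.single w b"
      using update.hyps(1)
      by (intro poly_mapping_eqI)
         (auto simp: lookup_update lookup_add lookup_single when_def in_keys_iff)
    thus ?case
      using update.IH by (simp add: distrib_left distrib_right mult_single mult.commute)
  qed simp
  have single_mult_assoc: "Poly_Mapping.single 0 (c * d) * p =
      Poly_Mapping.single 0 c * (Poly_Mapping.single 0 d * p)" for c d :: 'k and p :: "'l word \<Rightarrow>\<^sub>0 'k"
    by (simp add: mult_single flip: mult.assoc)
  let ?F = "free_algebra :: ('k, 'l word \<Rightarrow>\<^sub>0 'k) module"
  let ?K = "ring_of_type_algebra :: 'k ring"
  have ag: "abelian_group ?F"
    by (rule abelian_groupI)
       (auto simp: free_algebra_def algebra_simps intro: exI[of _ "- x" for x])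
  have ring: "ring ?F"
    by (rule ringI[OF ag]) (auto simp: free_algebra_def algebra_simps intro!: monoidI)
  have "module ?K ?F"
    by (rule moduleI[OF cring_from_type_algebra ag])
       (simp_all add: free_algebra_def ring_of_type_algebra_def mult_map_scale_conv_mult
          single_add distrib_left distrib_right single_mult_assoc)
  moreover have "assoc_algebra_axioms ?K ?F"
  proof
    fix c x y
    show "(c \<odot>\<^bsub>?F\<^esub> x) \<otimes>\<^bsub>?F\<^esub> y = c \<odot>\<^bsub>?F\<^esub> (x \<otimes>\<^bsub>?F\<^esub> y)"
      by (simp add: free_algebra_def mult_map_scale_conv_mult mult.assoc)
    show "x \<otimes>\<^bsub>?F\<^esub> (c \<odot>\<^bsub>?F\<^esub> y) = c \<odot>\<^bsub>?F\<^esub> (x \<otimes>\<^bsub>?F\<^esub> y)"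
      by (simp add: free_algebra_def mult_map_scale_conv_mult)
         (metis comm mult.assoc)
  qed
  ultimately show ?thesis using ring by (intro assoc_algebra.intro)
qed

text \<open>
  The words of length \<open>k\<close> span the free vector space on \<open>L\<^sup>k\<close>, and the relations between them are
  those of multilinearity, so that its image in the quotient is the tensor power of \<open>L\<close> of degree
  \<open>k\<close>. The set of relations is closed under concatenation with words on either side, so its linear
  span is already the ideal it generates.
\<close>

definition multilinearity_relations ::
    "('k::field \<Rightarrow> 'l::ab_group_add \<Rightarrow> 'l) \<Rightarrow> ('l word \<Rightarrow>\<^sub>0 'k) set"
  where "multilinearity_relations scale =
    {Poly_Mapping.single (Word (us @ (x + y) # vs)) 1
       - Poly_Mapping.single (Word (us @ x # vs)) 1 - Poly_Mapping.single (Word (us @ y # vs)) 1 | us vs x y. True} \<union>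
    {Poly_Mapping.single (Word (us @ scale c x # vs)) 1 - Poly_Mapping.single (Word (us @ x # vs)) c | us vs c x. True}"

definition tensor_ideal :: "('k::field \<Rightarrow> 'l::ab_group_add \<Rightarrow> 'l) \<Rightarrow> ('l word \<Rightarrow>\<^sub>0 'k) set"
  where "tensor_ideal scale = Idl\<^bsub>free_algebra\<^esub> (multilinearity_relations scale)"

definition tensor_algebra ::
    "('k::field \<Rightarrow> 'l::ab_group_add \<Rightarrow> 'l) \<Rightarrow> ('k, ('l word \<Rightarrow>\<^sub>0 'k) set) module"
  where "tensor_algebra scale = quotient_algebra free_algebra (tensor_ideal scale)"

definition to_tensor ::
    "('k::field \<Rightarrow> 'l::ab_group_add \<Rightarrow> 'l) \<Rightarrow> 'l \<Rightarrow> ('l word \<Rightarrow>\<^sub>0 'k) set"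
  where "to_tensor scale x = tensor_ideal scale +>\<^bsub>free_algebra\<^esub> Poly_Mapping.single (Word [x]) 1"

lemma tensor_ideal: "ideal (tensor_ideal scale) free_algebra"
proof -
  interpret assoc_algebra "ring_of_type_algebra" free_algebra
    by (rule free_algebra_assoc_algebra)
  show ?thesis
    unfolding tensor_ideal_def by (rule A.genideal_ideal) (simp add: free_algebra_def)
qed

lemma tensor_algebra_assoc_algebra:
  "assoc_algebra ring_of_type_algebra (tensor_algebra scale)"
  unfolding tensor_algebra_def
  by (rule assoc_algebra.quotient_algebra_assoc_algebra
      [OF free_algebra_assoc_algebra tensor_ideal])

lemma to_tensor_closed: "to_tensor scale x \<in> carrier (tensor_algebra scale)"
proof -
  interpret ideal "tensor_ideal scale" free_algebra by (rule tensor_ideal)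
  show ?thesis
    unfolding to_tensor_def tensor_algebra_def quotient_algebra_simps
    by (rule a_rcosetsI[OF a_subset]) (simp add: free_algebra_def)
qed


section \<open>The universal enveloping algebra\<close>

definition enveloping_relations ::
    "('k::field \<Rightarrow> 'l::ab_group_add \<Rightarrow> 'l) \<Rightarrow> ('l \<Rightarrow> 'l \<Rightarrow> 'l) \<Rightarrow> ('l word \<Rightarrow>\<^sub>0 'k) set set"
  where "enveloping_relations scale mul =
    (let T = tensor_algebra scale; \<iota> = to_tensor scale in
      {((1/2) \<odot>\<^bsub>T\<^esub> (\<iota> x \<otimes>\<^bsub>T\<^esub> \<iota> y \<oplus>\<^bsub>T\<^esub> \<iota> y \<otimes>\<^bsub>T\<^esub> \<iota> x)) \<ominus>\<^bsub>T\<^esub> \<iota> (mul x y) | x y. True})"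

definition enveloping_ideal ::
    "('k::field \<Rightarrow> 'l::ab_group_add \<Rightarrow> 'l) \<Rightarrow> ('l \<Rightarrow> 'l \<Rightarrow> 'l) \<Rightarrow> ('l word \<Rightarrow>\<^sub>0 'k) set set"
  where "enveloping_ideal scale mul = Idl\<^bsub>tensor_algebra scale\<^esub> (enveloping_relations scale mul)"

definition enveloping_algebra ::
    "('k::field \<Rightarrow> 'l::ab_group_add \<Rightarrow> 'l) \<Rightarrow> ('l \<Rightarrow> 'l \<Rightarrow> 'l) \<Rightarrow>
      ('k, ('l word \<Rightarrow>\<^sub>0 'k) set set) module"
  where "enveloping_algebra scale mul =
    quotient_algebra (tensor_algebra scale) (enveloping_ideal scale mul)"

definition to_enveloping ::
    "('k::field \<Rightarrow> 'l::ab_group_add \<Rightarrow> 'l) \<Rightarrow> ('l \<Rightarrow> 'l \<Rightarrow> 'l) \<Rightarrow> 'l \<Rightarrow>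
      ('l word \<Rightarrow>\<^sub>0 'k) set set"
  where "to_enveloping scale mul x =
    enveloping_ideal scale mul +>\<^bsub>tensor_algebra scale\<^esub> to_tensor scale x"

lemma enveloping_relations_closed:
  "enveloping_relations scale mul \<subseteq> carrier (tensor_algebra scale)"
proof -
  interpret assoc_algebra "ring_of_type_algebra" "tensor_algebra scale"
    by (rule tensor_algebra_assoc_algebra)
  show ?thesis
    unfolding enveloping_relations_def Let_def
    by (auto intro!: M.minus_closed smult_closed M.a_closed A.m_closed to_tensor_closed
        simp: ring_of_type_algebra_def)
qed

lemma enveloping_ideal: "ideal (enveloping_ideal scale mul) (tensor_algebra scale)"
proof -
  interpret assoc_algebra "ring_of_type_algebra" "tensor_algebra scale"
    by (rule tensor_algebra_assoc_algebra)
  show ?thesis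
    unfolding enveloping_ideal_def
    by (rule A.genideal_ideal[OF enveloping_relations_closed])
qed

lemma enveloping_algebra_assoc_algebra:
  "assoc_algebra ring_of_type_algebra (enveloping_algebra scale mul)"
  unfolding enveloping_algebra_def
  by (rule assoc_algebra.quotient_algebra_assoc_algebra
      [OF tensor_algebra_assoc_algebra enveloping_ideal])

lemma enveloping_algebra_vectorspace:
  "vectorspace ring_of_type_algebra (enveloping_algebra scale mul)"
proof -
  interpret assoc_algebra "ring_of_type_algebra" "enveloping_algebra scale mul"
    by (rule enveloping_algebra_assoc_algebra)
  show ?thesis by (intro vectorspace.intro module_axioms field_from_type_algebra)
qed

lemma to_enveloping_closed: "to_enveloping scale mul x \<in> carrier (enveloping_algebra scale mul)"
proof -
  interpret ideal "enveloping_ideal scale mul" "tensor_algebra scale" by (rule enveloping_ideal)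
  show ?thesis
    unfolding to_enveloping_def enveloping_algebra_def quotient_algebra_simps
    by (rule a_rcosetsI[OF a_subset to_tensor_closed])
qed

definition increasing_sequences :: "nat \<Rightarrow> nat list set"
  where "increasing_sequences n = {is. sorted_wrt (<) is \<and> set is \<subseteq> {1..n}}"

definition pbw_monomial ::
    "('k::field \<Rightarrow> 'l::ab_group_add \<Rightarrow> 'l) \<Rightarrow> ('l \<Rightarrow> 'l \<Rightarrow> 'l) \<Rightarrow> (nat \<Rightarrow> 'l) \<Rightarrow> nat list \<Rightarrow>
      ('l word \<Rightarrow>\<^sub>0 'k) set set"
  where "pbw_monomial scale mul x is =
    (let U = enveloping_algebra scale mul in
      foldr (\<lambda>i u. to_enveloping scale mul (x i) \<otimes>\<^bsub>U\<^esub> u) is \<one>\<^bsub>U\<^esub>)"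

end

theory Submission
  imports Defs
begin

text \<open>
  In \<open>U(L)\<close> the relations read \<open>v w + w v = 2 (v \<circ> w)\<close>, and in particular \<open>v v = v \<circ> v\<close>. So
  \<open>U(L)\<close> is a candidate deformation of the exterior algebra, and the ordered squarefree monomials
  always span it. The question is whether they collapse.

  They do collapse as soon as some square \<open>y = v \<circ> v\<close> is nonzero. The Jacobi identity at \<open>v, v, v\<close>
  gives \<open>3 (v \<circ> y) = 0\<close>, hence \<open>v y + y v = 2 (v \<circ> y) = 0\<close> in \<open>U(L)\<close>; but \<open>y\<close> is also the
  associative square \<open>v v\<close> there, so it commutes with \<open>v\<close>, and \<open>v y = y v = 0\<close>
  (\<open>gen_mult_square\<close>). If \<open>v\<close> and \<open>y\<close> have coordinates \<open>a\<close> and \<open>b\<close>, then the coefficient of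
  \<open>x\<^sub>i x\<^sub>j\<close>, \<open>i < j\<close>, in the ordered form of \<open>v y - y v\<close> is \<open>2 (a\<^sub>i b\<^sub>j - a\<^sub>j b\<^sub>i)\<close>, and the remaining terms
  are linear in the \<open>x\<^sub>k\<close>. Independence of the monomials makes these minors vanish, so \<open>y\<close> is a
  multiple of \<open>v\<close> (\<open>square_proportional\<close>), say \<open>y = c v\<close>. Then \<open>0 = v \<circ> y = c\<^sup>2 v\<close> forces \<open>y = 0\<close>. As
  all squares vanish, polarisation makes the product zero (\<open>abelian_if_squares_proportional\<close>).

  If \<open>L\<close> is abelian, then \<open>U(L)\<close> is the exterior algebra. Anticommutation sorts every
  product of basis vectors, which gives spanning (\<open>increasing_products_span\<close>). For independence,
  \<open>U(L)\<close> acts on the functions on the subsets of \<open>\<nat>\<close> by exterior multiplication, and the monomial of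
  an increasing sequence takes the indicator of the empty set to the indicator of the set of its
  entries; distinct monomials thus have independent images (\<open>increasing_products_independent\<close>).

  All computations take place in the free associative algebra on the set \<open>L\<close>, whose operations are
  those of a type class, modulo the kernel of its map onto \<open>U(L)\<close>. That the two successive
  quotients defining \<open>U(L)\<close> amount to this one is \<open>enveloping_class_eq_zero_iff\<close>; the basis property is
  translated by \<open>basis_image_iff\<close>.
\<close>

section \<open>The enveloping algebra as one quotient of the free algebra\<close>

lemma (in assoc_algebra) quotient_map:
  assumes I: "ideal I A"
  defines "Q \<equiv> quotient_algebra A I"
  shows "x \<in> carrier A \<Longrightarrow> I +>\<^bsub>A\<^esub> x \<in> carrier Q"
    and "\<lbrakk>x \<in> carrier A; y \<in> carrier A\<rbrakk> \<Longrightarrow>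
      (I +>\<^bsub>A\<^esub> x) \<oplus>\<^bsub>Q\<^esub> (I +>\<^bsub>A\<^esub> y) = I +>\<^bsub>A\<^esub> (x \<oplus>\<^bsub>A\<^esub> y)"
    and "\<lbrakk>x \<in> carrier A; y \<in> carrier A\<rbrakk> \<Longrightarrow>
      (I +>\<^bsub>A\<^esub> x) \<otimes>\<^bsub>Q\<^esub> (I +>\<^bsub>A\<^esub> y) = I +>\<^bsub>A\<^esub> (x \<otimes>\<^bsub>A\<^esub> y)"
    and "\<lbrakk>c \<in> carrier K; x \<in> carrier A\<rbrakk> \<Longrightarrow>
      c \<odot>\<^bsub>Q\<^esub> (I +>\<^bsub>A\<^esub> x) = I +>\<^bsub>A\<^esub> (c \<odot>\<^bsub>A\<^esub> x)"
    and "\<one>\<^bsub>Q\<^esub> = I +>\<^bsub>A\<^esub> \<one>\<^bsub>A\<^esub>"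
    and "x \<in> carrier A \<Longrightarrow> I +>\<^bsub>A\<^esub> x = \<zero>\<^bsub>Q\<^esub> \<longleftrightarrow> x \<in> I"
    and "u \<in> carrier Q \<Longrightarrow> \<exists>x\<in>carrier A. u = I +>\<^bsub>A\<^esub> x"
proof -
  interpret I: ideal I A by fact
  show "x \<in> carrier A \<Longrightarrow> I +>\<^bsub>A\<^esub> x \<in> carrier Q"
    by (simp add: Q_def quotient_algebra_simps M.a_rcosetsI[OF I.a_subset])
  show "\<lbrakk>x \<in> carrier A; y \<in> carrier A\<rbrakk> \<Longrightarrow>
      (I +>\<^bsub>A\<^esub> x) \<oplus>\<^bsub>Q\<^esub> (I +>\<^bsub>A\<^esub> y) = I +>\<^bsub>A\<^esub> (x \<oplus>\<^bsub>A\<^esub> y)"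
    by (simp add: Q_def quotient_algebra_simps I.a_rcos_sum)
  show "\<lbrakk>x \<in> carrier A; y \<in> carrier A\<rbrakk> \<Longrightarrow>
      (I +>\<^bsub>A\<^esub> x) \<otimes>\<^bsub>Q\<^esub> (I +>\<^bsub>A\<^esub> y) = I +>\<^bsub>A\<^esub> (x \<otimes>\<^bsub>A\<^esub> y)"
    by (simp add: Q_def quotient_algebra_simps I.rcoset_mult_add)
  show "\<lbrakk>c \<in> carrier K; x \<in> carrier A\<rbrakk> \<Longrightarrow>
      c \<odot>\<^bsub>Q\<^esub> (I +>\<^bsub>A\<^esub> x) = I +>\<^bsub>A\<^esub> (c \<odot>\<^bsub>A\<^esub> x)"
    unfolding Q_def by (rule quotient_smult[OF I])
  show "\<one>\<^bsub>Q\<^esub> = I +>\<^bsub>A\<^esub> \<one>\<^bsub>A\<^esub>"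
    by (simp add: Q_def quotient_algebra_simps)
  show "x \<in> carrier A \<Longrightarrow> I +>\<^bsub>A\<^esub> x = \<zero>\<^bsub>Q\<^esub> \<longleftrightarrow> x \<in> I"
    using I.rcos_const_imp_mem A.a_rcos_zero[OF I]
    by (auto simp: Q_def quotient_algebra_simps)
  show "u \<in> carrier Q \<Longrightarrow> \<exists>x\<in>carrier A. u = I +>\<^bsub>A\<^esub> x"
    by (auto simp: Q_def quotient_algebra_simps A_RCOSETS_def' a_r_coset_def r_coset_def)
qed

interpretation F: assoc_algebra ring_of_type_algebra "free_algebra :: ('k::field, 'l word \<Rightarrow>\<^sub>0 'k) module"
  by (rule free_algebra_assoc_algebra)

lemma free_algebra_simps [simp]:
  "carrier free_algebra = UNIV" "monoid.mult free_algebra = (*)" "one free_algebra = 1"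
  "ring.zero free_algebra = 0" "add free_algebra = (+)"
  "module.smult free_algebra c p = Poly_Mapping.single 0 c * p"
  by (simp_all add: free_algebra_def mult_map_scale_conv_mult)

lemma carrier_ring_of_type_algebra [simp]: "carrier ring_of_type_algebra = UNIV"
  by (simp add: ring_of_type_algebra_def)

lemma free_algebra_minus [simp]: "\<ominus>\<^bsub>free_algebra\<^esub> p = - p" "p \<ominus>\<^bsub>free_algebra\<^esub> q = p - q"
proof -
  show *: "\<ominus>\<^bsub>free_algebra\<^esub> p = - p" for p :: "'l word \<Rightarrow>\<^sub>0 'k::field"
    by (rule F.minus_equality) simp_all
  show "p \<ominus>\<^bsub>free_algebra\<^esub> q = p - q"
    by (simp add: a_minus_def *)
qed

definition gen :: "'l \<Rightarrow> ('l word \<Rightarrow>\<^sub>0 'k::field)"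
  where "gen v = Poly_Mapping.single (Word [v]) 1"

abbreviation const :: "'k \<Rightarrow> ('l word \<Rightarrow>\<^sub>0 'k::field)"
  where "const c \<equiv> Poly_Mapping.single 0 c"

text \<open>
  The two-sided ideal of the free algebra generated at once by linearity of \<open>gen\<close> and by the
  relations of \<open>U(L)\<close>. Multilinearity at an inner position of a word needs no clause of its own: it
  arises from the linearity of \<open>gen\<close> by multiplying with words on both sides.
\<close>

inductive_set enveloping_kernel :: "('k::field \<Rightarrow> 'l::ab_group_add \<Rightarrow> 'l) \<Rightarrow> ('l \<Rightarrow> 'l \<Rightarrow> 'l) \<Rightarrow> ('l word \<Rightarrow>\<^sub>0 'k) set"
  for scale :: "'k::field \<Rightarrow> 'l::ab_group_add \<Rightarrow> 'l" and mul where
  zero: "0 \<in> enveloping_kernel scale mul"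
| add: "\<lbrakk>p \<in> enveloping_kernel scale mul; q \<in> enveloping_kernel scale mul\<rbrakk> \<Longrightarrow> p + q \<in> enveloping_kernel scale mul"
| mult: "p \<in> enveloping_kernel scale mul \<Longrightarrow> q * p * r \<in> enveloping_kernel scale mul"
| gen_add: "gen (v + w) - gen v - gen w \<in> enveloping_kernel scale mul"
| gen_scale: "gen (scale c v) - const c * gen v \<in> enveloping_kernel scale mul"
| gen_mul: "const (1/2) * (gen v * gen w + gen w * gen v) - gen (mul v w) \<in> enveloping_kernel scale mul"

lemma enveloping_kernel_mult_left: "p \<in> enveloping_kernel scale mul \<Longrightarrow> q * p \<in> enveloping_kernel scale mul"
  using enveloping_kernel.mult[of p scale mul q 1] by simp

lemma enveloping_kernel_mult_right: "p \<in> enveloping_kernel scale mul \<Longrightarrow> p * q \<in> enveloping_kernel scale mul"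
  using enveloping_kernel.mult[of p scale mul 1 q] by simp

lemma enveloping_kernel_uminus: "p \<in> enveloping_kernel scale mul \<Longrightarrow> - p \<in> enveloping_kernel scale mul"
  using enveloping_kernel_mult_left[of p scale mul "- 1"] by simp

lemma enveloping_kernel_minus:
  "p \<in> enveloping_kernel scale mul \<Longrightarrow> q \<in> enveloping_kernel scale mul \<Longrightarrow> p - q \<in> enveloping_kernel scale mul"
  using enveloping_kernel.add[of p scale mul "- q"] enveloping_kernel_uminus[of q] by simp

lemma subgroup_free_algebraI:
  assumes "0 \<in> S" "\<And>p q. p \<in> S \<Longrightarrow> q \<in> S \<Longrightarrow> p + q \<in> S" "\<And>p. p \<in> S \<Longrightarrow> - p \<in> S"
  shows "subgroup S (add_monoid free_algebra)"
proof
  fix p assume "p \<in> S"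
  then show "inv\<^bsub>add_monoid free_algebra\<^esub> p \<in> S"
    using assms(3) free_algebra_minus(1)[of p] unfolding a_inv_def by simp
qed (use assms in auto)

lemma ideal_enveloping_kernel: "ideal (enveloping_kernel scale mul) free_algebra"
  by (rule idealI[OF F.A.ring_axioms subgroup_free_algebraI])
     (simp_all add: enveloping_kernel.intros enveloping_kernel_uminus
        enveloping_kernel_mult_left enveloping_kernel_mult_right)

lemma single_Word_insert:
  "Poly_Mapping.single (Word (us @ v # vs)) c =
    Poly_Mapping.single (Word us) 1 * (const c * gen v) * Poly_Mapping.single (Word vs) 1"
  by (simp add: mult_single plus_word_def zero_word_def gen_def)

lemma tensor_ideal_subset: "tensor_ideal scale \<subseteq> enveloping_kernel scale mul"
proof -
  have "Poly_Mapping.single (Word (us @ (v + w) # vs)) 1 - Poly_Mapping.single (Word (us @ v # vs)) 1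
      - Poly_Mapping.single (Word (us @ w # vs)) 1 \<in> enveloping_kernel scale mul" for us vs v w
    using enveloping_kernel.mult[OF enveloping_kernel.gen_add,
        where q = "Poly_Mapping.single (Word us) 1" and r = "Poly_Mapping.single (Word vs) 1"]
    unfolding single_Word_insert by (simp add: algebra_simps)
  moreover have "Poly_Mapping.single (Word (us @ scale c v # vs)) 1 - Poly_Mapping.single (Word (us @ v # vs)) c
      \<in> enveloping_kernel scale mul" for us vs v c
    using enveloping_kernel.mult[OF enveloping_kernel.gen_scale,
        where q = "Poly_Mapping.single (Word us) 1" and r = "Poly_Mapping.single (Word vs) 1"]
    unfolding single_Word_insert by (simp add: algebra_simps)
  ultimately have "multilinearity_relations scale \<subseteq> enveloping_kernel scale mul"
    by (auto simp: multilinearity_relations_def)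
  then show ?thesis
    unfolding tensor_ideal_def by (rule F.A.genideal_minimal[OF ideal_enveloping_kernel])
qed

lemma multilinearity_relations_subset: "multilinearity_relations scale \<subseteq> tensor_ideal scale"
  unfolding tensor_ideal_def by (rule F.A.genideal_self) simp

context
  fixes scale :: "'k::field \<Rightarrow> 'l::ab_group_add \<Rightarrow> 'l" and mul :: "'l \<Rightarrow> 'l \<Rightarrow> 'l"
begin

interpretation T: assoc_algebra ring_of_type_algebra "tensor_algebra scale"
  by (rule tensor_algebra_assoc_algebra)

interpretation U: assoc_algebra ring_of_type_algebra "enveloping_algebra scale mul"
  by (rule enveloping_algebra_assoc_algebra)

lemma enveloping_relations_subset: "enveloping_relations scale mul \<subseteq> enveloping_ideal scale mul"
  unfolding enveloping_ideal_def by (rule T.A.genideal_self[OF enveloping_relations_closed])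

text \<open>
  The maps from the free algebra onto \<open>T(L)\<close> and onto \<open>U(L)\<close>. Every element of either algebra is
  the class of some \<open>p\<close>, so an equation between elements of \<open>U(L)\<close> can be checked on representatives.
\<close>

definition tensor_class :: "('l word \<Rightarrow>\<^sub>0 'k) \<Rightarrow> ('l word \<Rightarrow>\<^sub>0 'k) set"
  where "tensor_class p = tensor_ideal scale +>\<^bsub>free_algebra\<^esub> p"

definition enveloping_class :: "('l word \<Rightarrow>\<^sub>0 'k) \<Rightarrow> ('l word \<Rightarrow>\<^sub>0 'k) set set"
  where "enveloping_class p = enveloping_ideal scale mul +>\<^bsub>tensor_algebra scale\<^esub> tensor_class p"

lemmas tensor_map = F.quotient_map[OF tensor_ideal[of scale], folded tensor_algebra_def, simplified]

lemma tensor_class: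
  "tensor_class p \<in> carrier (tensor_algebra scale)"
  "tensor_class p \<oplus>\<^bsub>tensor_algebra scale\<^esub> tensor_class q = tensor_class (p + q)"
  "tensor_class p \<otimes>\<^bsub>tensor_algebra scale\<^esub> tensor_class q = tensor_class (p * q)"
  "c \<odot>\<^bsub>tensor_algebra scale\<^esub> tensor_class p = tensor_class (const c * p)"
  "\<one>\<^bsub>tensor_algebra scale\<^esub> = tensor_class 1"
  "tensor_class p = \<zero>\<^bsub>tensor_algebra scale\<^esub> \<longleftrightarrow> p \<in> tensor_ideal scale"
  "u \<in> carrier (tensor_algebra scale) \<Longrightarrow> \<exists>p. u = tensor_class p"
  unfolding tensor_class_def by (simp_all add: tensor_map)

lemma tensor_class_minus:
  "\<ominus>\<^bsub>tensor_algebra scale\<^esub> tensor_class p = tensor_class (- p)"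
  "tensor_class p \<ominus>\<^bsub>tensor_algebra scale\<^esub> tensor_class q = tensor_class (p - q)"
proof -
  interpret I: ideal "tensor_ideal scale" free_algebra by (rule tensor_ideal)
  have 0: "tensor_class 0 = \<zero>\<^bsub>tensor_algebra scale\<^esub>"
    using I.zero_closed by (simp add: tensor_class)
  show *: "\<ominus>\<^bsub>tensor_algebra scale\<^esub> tensor_class p = tensor_class (- p)" for p
    by (rule T.minus_equality) (simp_all add: tensor_class(1,2) 0)
  show "tensor_class p \<ominus>\<^bsub>tensor_algebra scale\<^esub> tensor_class q = tensor_class (p - q)"
    by (simp add: a_minus_def * tensor_class)
qed

lemma enveloping_class:
  "enveloping_class p \<in> carrier (enveloping_algebra scale mul)"
  "enveloping_class p \<oplus>\<^bsub>enveloping_algebra scale mul\<^esub> enveloping_class q = enveloping_class (p + q)"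
  "enveloping_class p \<otimes>\<^bsub>enveloping_algebra scale mul\<^esub> enveloping_class q = enveloping_class (p * q)"
  "c \<odot>\<^bsub>enveloping_algebra scale mul\<^esub> enveloping_class p = enveloping_class (const c * p)"
  "\<one>\<^bsub>enveloping_algebra scale mul\<^esub> = enveloping_class 1"
  "u \<in> carrier (enveloping_algebra scale mul) \<Longrightarrow> \<exists>p. u = enveloping_class p"
  and enveloping_class_eq_zero_iff_tensor:
  "enveloping_class p = \<zero>\<^bsub>enveloping_algebra scale mul\<^esub> \<longleftrightarrow> tensor_class p \<in> enveloping_ideal scale mul"
  unfolding enveloping_class_def
  using T.quotient_map[OF enveloping_ideal[of scale mul], folded enveloping_algebra_def]
  by (simp_all add: tensor_class) (metis tensor_class(7))

lemma to_enveloping_eq: "to_enveloping scale mul v = enveloping_class (gen v)"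
  by (simp add: to_enveloping_def enveloping_class_def to_tensor_def tensor_class_def gen_def)

lemma enveloping_relation_eq:
  "((1/2) \<odot>\<^bsub>tensor_algebra scale\<^esub> (to_tensor scale v \<otimes>\<^bsub>tensor_algebra scale\<^esub> to_tensor scale w
      \<oplus>\<^bsub>tensor_algebra scale\<^esub> to_tensor scale w \<otimes>\<^bsub>tensor_algebra scale\<^esub> to_tensor scale v))
      \<ominus>\<^bsub>tensor_algebra scale\<^esub> to_tensor scale (mul v w)
    = tensor_class (const (1/2) * (gen v * gen w + gen w * gen v) - gen (mul v w))"
proof -
  have *: "to_tensor scale v = tensor_class (gen v)" for v
    by (simp add: to_tensor_def tensor_class_def gen_def)
  show ?thesis
    by (simp only: * tensor_class tensor_class_minus)
qed

text \<open>
  An instance of the third isomorphism theorem. One inclusion is an induction over the generated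
  ideal. For the other, the image of \<open>enveloping_kernel\<close> in \<open>T(L)\<close> is an ideal, since the map is onto,
  and it contains the enveloping relations; as \<open>enveloping_kernel\<close> contains the kernel of the map to
  \<open>T(L)\<close>, it is the full preimage of that image.
\<close>

lemma enveloping_class_eq_zero_iff:
  "enveloping_class p = \<zero>\<^bsub>enveloping_algebra scale mul\<^esub> \<longleftrightarrow> p \<in> enveloping_kernel scale mul"
proof
  interpret J: ideal "enveloping_ideal scale mul" "tensor_algebra scale" by (rule enveloping_ideal)
  have tens: "tensor_class p \<in> enveloping_ideal scale mul" if "p \<in> tensor_ideal scale" for p
    using that J.zero_closed by (metis tensor_class(6))
  {
    assume "p \<in> enveloping_kernel scale mul"
    then have "tensor_class p \<in> enveloping_ideal scale mul"
    proof induction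
      case zero
      have "(0 :: 'l word \<Rightarrow>\<^sub>0 'k) \<in> tensor_ideal scale"
        using additive_subgroup.zero_closed[OF ideal.axioms(1)[OF tensor_ideal, of scale]] by simp
      then show ?case by (rule tens)
    next
      case (add p q)
      then show ?case using J.a_closed[of "tensor_class p" "tensor_class q"] by (simp add: tensor_class)
    next
      case (mult p q r)
      then show ?case
        using J.I_r_closed[OF J.I_l_closed, of "tensor_class p" "tensor_class q" "tensor_class r"]
        by (simp add: tensor_class)
    next
      case (gen_add v w)
      have "gen (v + w) - gen v - gen w \<in> multilinearity_relations scale"
        unfolding multilinearity_relations_def gen_def
        by (intro UnI1 CollectI exI[of _ "[]"] exI[of _ v] exI[of _ w]) simp
      then show ?case
        using tens multilinearity_relations_subset by blast
    next
      case (gen_scale c v)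
      have "gen (scale c v) - const c * gen v \<in> multilinearity_relations scale"
        by (auto simp: multilinearity_relations_def gen_def mult_single
            intro!: exI[of _ "[]"] exI[of _ c] exI[of _ v])
      then show ?case
        using tens multilinearity_relations_subset by blast
    next
      case (gen_mul v w)
      have "tensor_class (const (1/2) * (gen v * gen w + gen w * gen v) - gen (mul v w))
          \<in> enveloping_relations scale mul"
        unfolding enveloping_relations_def Let_def enveloping_relation_eq by blast
      then show ?case
        using enveloping_relations_subset by blast
    qed
    then show "enveloping_class p = \<zero>\<^bsub>enveloping_algebra scale mul\<^esub>"
      by (simp add: enveloping_class_eq_zero_iff_tensor)
  }
  {
    assume p: "enveloping_class p = \<zero>\<^bsub>enveloping_algebra scale mul\<^esub>"
    have "ideal (tensor_class ` enveloping_kernel scale mul) (tensor_algebra scale)"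
    proof (rule idealI[OF T.A.ring_axioms])
      show "subgroup (tensor_class ` enveloping_kernel scale mul) (add_monoid (tensor_algebra scale))"
      proof
        show "\<one>\<^bsub>add_monoid (tensor_algebra scale)\<^esub> \<in> tensor_class ` enveloping_kernel scale mul"
          using additive_subgroup.zero_closed[OF ideal.axioms(1)[OF tensor_ideal, of scale]]
          by (auto intro!: image_eqI[of _ _ 0] enveloping_kernel.zero simp: tensor_class(6)[of 0, symmetric]
               tensor_class(6)[of 0, THEN iffD2])
      qed (auto simp: tensor_class(1,2) tensor_class_minus enveloping_kernel.add enveloping_kernel_uminus
             simp flip: a_inv_def)
      show "v \<otimes>\<^bsub>tensor_algebra scale\<^esub> u \<in> tensor_class ` enveloping_kernel scale mul"
        "u \<otimes>\<^bsub>tensor_algebra scale\<^esub> v \<in> tensor_class ` enveloping_kernel scale mul"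
        if "u \<in> tensor_class ` enveloping_kernel scale mul" "v \<in> carrier (tensor_algebra scale)" for u v
        using that tensor_class(7)[of v]
        by (auto simp: tensor_class(3) enveloping_kernel_mult_left enveloping_kernel_mult_right)
    qed
    moreover have "enveloping_relations scale mul \<subseteq> tensor_class ` enveloping_kernel scale mul"
      unfolding enveloping_relations_def Let_def enveloping_relation_eq
      by (auto intro: enveloping_kernel.gen_mul)
    ultimately have "enveloping_ideal scale mul \<subseteq> tensor_class ` enveloping_kernel scale mul"
      unfolding enveloping_ideal_def by (rule T.A.genideal_minimal)
    then obtain q where q: "q \<in> enveloping_kernel scale mul" "tensor_class p = tensor_class q"
      using p by (auto simp: enveloping_class_eq_zero_iff_tensor)
    have "tensor_class (p - q) = \<zero>\<^bsub>tensor_algebra scale\<^esub>"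
      using q(2) tensor_class_minus(2)[of q q] additive_subgroup.zero_closed[OF ideal.axioms(1)[OF tensor_ideal, of scale]]
      by (simp flip: tensor_class_minus) (simp add: tensor_class_minus tensor_class)
    then have "p - q \<in> enveloping_kernel scale mul"
      using tensor_ideal_subset by (auto simp: tensor_class(6))
    then show "p \<in> enveloping_kernel scale mul"
      using enveloping_kernel.add[OF _ q(1), of "p - q"] by simp
  }
qed

section \<open>Bases of the enveloping algebra, read in the free algebra\<close>

lemma pbw_monomial_eq:
  "pbw_monomial scale mul x is = enveloping_class (prod_list (map (\<lambda>i. gen (x i)) is))"
  unfolding pbw_monomial_def Let_def
  by (induction "is") (simp_all add: to_enveloping_eq enveloping_class(3,5))

lemma enveloping_class_sum:
  assumes "finite S"
  shows "enveloping_class (\<Sum>s\<in>S. const (c s) * m s) =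
    (\<Oplus>\<^bsub>enveloping_algebra scale mul\<^esub>s\<in>S. c s \<odot>\<^bsub>enveloping_algebra scale mul\<^esub> enveloping_class (m s))"
  using assms
proof (induction S)
  case empty
  then show ?case
    by (simp add: enveloping_class_eq_zero_iff enveloping_kernel.zero)
next
  case (insert s S)
  then show ?case
    by (simp add: U.finsum_insert enveloping_class(1,2,4) Pi_def flip: enveloping_class(2))
qed

lemma range_eq_range_iff:
  "range f \<subseteq> range g \<Longrightarrow> range f = range g \<longleftrightarrow> (\<forall>p. \<exists>c. g p = f c)"
  by (metis UNIV_I image_iff image_subset_iff subset_antisym subsetI)

text \<open>
  The coefficients are indexed by \<open>S\<close> rather than by the set of monomials, so the independence
  condition on the right also detects coincidences \<open>m s = m t\<close> modulo the kernel; it therefore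
  accounts for the injectivity on the left.
\<close>

lemma basis_image_iff:
  assumes fin: "finite S"
  shows "inj_on (\<lambda>s. enveloping_class (m s)) S \<and>
      vectorspace.basis ring_of_type_algebra (enveloping_algebra scale mul) ((\<lambda>s. enveloping_class (m s)) ` S) \<longleftrightarrow>
    (\<forall>p. \<exists>c. p - (\<Sum>s\<in>S. const (c s) * m s) \<in> enveloping_kernel scale mul) \<and>
    (\<forall>c. (\<Sum>s\<in>S. const (c s) * m s) \<in> enveloping_kernel scale mul \<longrightarrow> (\<forall>s\<in>S. c s = 0))"
    (is "?inj \<and> ?basis \<longleftrightarrow> ?span \<and> ?indep")
proof -
  let ?m = "\<lambda>s. enveloping_class (m s)"
  have carr: "?m ` S \<subseteq> carrier (enveloping_algebra scale mul)"
    by (auto simp: enveloping_class)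
  have zero: "\<zero>\<^bsub>ring_of_type_algebra\<^esub> = (0 :: 'k)"
    by (simp add: ring_of_type_algebra_def)
  have lincomb: "U.lincomb a (?m ` S) = enveloping_class (\<Sum>s\<in>S. const (a (?m s)) * m s)" if ?inj for a
    unfolding U.lincomb_def enveloping_class_sum[OF fin] using that
    by (subst U.add.finprod_reindex[simplified]) (auto simp: enveloping_class(1,4) Pi_def finsum_def)
  have eq: "enveloping_class p = enveloping_class q \<longleftrightarrow> p - q \<in> enveloping_kernel scale mul" for p q
  proof -
    have "enveloping_class p = enveloping_class (p - q) \<oplus>\<^bsub>enveloping_algebra scale mul\<^esub> enveloping_class q"
      by (simp add: enveloping_class(2))
    then have "enveloping_class p = enveloping_class q \<longleftrightarrow>
        enveloping_class (p - q) = \<zero>\<^bsub>enveloping_algebra scale mul\<^esub>"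
      using U.add.l_cancel_one by (simp add: enveloping_class(1))
    then show ?thesis by (simp add: enveloping_class_eq_zero_iff)
  qed
  have inj: ?inj if ?indep
  proof (rule inj_onI, rule ccontr)
    fix s t assume st: "s \<in> S" "t \<in> S" "?m s = ?m t" "s \<noteq> t"
    \<comment> \<open>A coincidence is the linear relation with coefficients 1 and -1.\<close>
    define c :: "_ \<Rightarrow> 'k" where "c u = (if u = s then 1 else if u = t then - 1 else 0)" for u
    have "(\<Sum>u\<in>S. const (c u) * m u) = (\<Sum>u\<in>{s,t}. const (c u) * m u)"
      using st fin by (intro sum.mono_neutral_right) (auto simp: c_def)
    also have "\<dots> = m s - m t"
      using st(4) by (simp add: c_def single_uminus)
    also have "\<dots> \<in> enveloping_kernel scale mul"
      using st(3) eq by blast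
    finally have "c s = 0" using that st(1) by blast
    then show False by (simp add: c_def)
  qed
  have "?basis \<longleftrightarrow> ?span \<and> ?indep" if I: ?inj
  proof -
    \<comment> \<open>Coefficients on the index set are coefficients on the image, as the family is injective.\<close>
    have pull: "\<exists>a. \<forall>s\<in>S. a (?m s) = c s" for c :: "_ \<Rightarrow> 'k"
      by (intro exI[of _ "\<lambda>u. c (the_inv_into S ?m u)"] ballI arg_cong[of _ _ c] the_inv_into_f_f[OF I])
    have "\<not> U.lin_dep (?m ` S) \<longleftrightarrow> ?indep"
    proof
      assume li: "\<not> U.lin_dep (?m ` S)"
      show ?indep
      proof (intro allI impI ballI)
        fix c s assume c: "(\<Sum>s\<in>S. const (c s) * m s) \<in> enveloping_kernel scale mul" and s: "s \<in> S"
        obtain a where a: "\<forall>s\<in>S. a (?m s) = c s" using pull by blast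
        have "U.lincomb a (?m ` S) = \<zero>\<^bsub>enveloping_algebra scale mul\<^esub>"
          using c a by (simp add: lincomb[OF I] enveloping_class_eq_zero_iff cong: sum.cong)
        then have "a \<in> ?m ` S \<rightarrow> {0}"
          using vectorspace.not_lindepD[OF enveloping_algebra_vectorspace, OF li, of "?m ` S" a] fin by (simp add: zero)
        then show "c s = 0" using a s by (metis PiE imageI singletonD)
      qed
    next
      assume indep: ?indep
      show "\<not> U.lin_dep (?m ` S)"
      proof (rule U.finite_lin_indpt2)
        fix a assume "U.lincomb a (?m ` S) = \<zero>\<^bsub>enveloping_algebra scale mul\<^esub>"
        then show "\<forall>v\<in>?m ` S. a v = \<zero>\<^bsub>ring_of_type_algebra\<^esub>"
          using indep[THEN spec, of "\<lambda>s. a (?m s)"]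
          by (simp add: lincomb[OF I] enveloping_class_eq_zero_iff zero)
      qed (use fin carr in auto)
    qed
    moreover have "U.span (?m ` S) = carrier (enveloping_algebra scale mul) \<longleftrightarrow> ?span"
    proof -
      let ?F = "\<lambda>c. enveloping_class (\<Sum>s\<in>S. const (c s) * m s)"
      have "U.span (?m ` S) = range (\<lambda>a. ?F (\<lambda>s. a (?m s)))"
        using U.finite_span[OF _ carr] fin by (auto simp: lincomb[OF I])
      also have "\<dots> = range ?F"
      proof (intro equalityI subsetI)
        fix z assume "z \<in> range ?F"
        then obtain c where c: "z = ?F c" by blast
        obtain a where a: "\<forall>s\<in>S. a (?m s) = c s" using pull by blast
        then have "?F (\<lambda>s. a (?m s)) = ?F c"
          by (intro arg_cong[of _ _ enveloping_class] sum.cong) auto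
        then show "z \<in> range (\<lambda>a. ?F (\<lambda>s. a (?m s)))"
          using c by (intro image_eqI[of _ _ a]) simp_all
      qed auto
      finally have "U.span (?m ` S) = range ?F" .
      moreover have "carrier (enveloping_algebra scale mul) = range enveloping_class"
        using enveloping_class(1,6) by blast
      moreover have "range ?F \<subseteq> range enveloping_class"
        by blast
      ultimately have "U.span (?m ` S) = carrier (enveloping_algebra scale mul) \<longleftrightarrow>
          (\<forall>p. \<exists>c. enveloping_class p = ?F c)"
        by (simp only: range_eq_range_iff)
      then show ?thesis by (simp add: eq)
    qed
    ultimately show ?thesis
      using carr by (auto simp: vectorspace.basis_def[OF enveloping_algebra_vectorspace])
  qed
  then show ?thesis using inj by blast
qed

end

section \<open>Calculus modulo the enveloping relations\<close>

lemma poly_mapping_additive_induct: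
  assumes "\<And>w c. P (Poly_Mapping.single w c)" "\<And>p q. P p \<Longrightarrow> P q \<Longrightarrow> P (p + q)"
  shows "P (p :: 'w \<Rightarrow>\<^sub>0 'k::ab_group_add)"
proof (induction p rule: update_induct)
  case const
  show ?case using assms(1)[of _ 0] by simp
next
  case (update p w b)
  have "Poly_Mapping.update w b p = p + Poly_Mapping.single w b"
    using update.hyps(1)
    by (intro poly_mapping_eqI)
       (auto simp: lookup_update lookup_add lookup_single when_def in_keys_iff)
  then show ?case using assms update.IH by simp
qed

lemma const_mult: "const (c * d) = const c * const d"
  by (simp add: mult_single)

lemma const_left_commute: "p * (const c * q) = const c * (p * q)" for p :: "'l word \<Rightarrow>\<^sub>0 'k::field"
  using F.smult_mult_right[of c p q] by simp

lemma const_half_double: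
  fixes p :: "'l word \<Rightarrow>\<^sub>0 'k::field"
  assumes "(2 :: 'k) \<noteq> 0"
  shows "const (1/2) * (p + p) = p"
proof -
  have "const (1/2) * (p + p) = (const (1/2) + const (1/2)) * p"
    by (simp only: distrib_left distrib_right)
  also have "const (1/2 :: 'k) + const (1/2) = (1 :: 'l word \<Rightarrow>\<^sub>0 'k)"
    using assms by (simp flip: single_add)
  finally show ?thesis by simp
qed

lemma const_mult_mult:
  fixes p q :: "'l word \<Rightarrow>\<^sub>0 'k::field"
  shows "(const c * p) * (const d * q) = const (c * d) * (p * q)"
  by (simp only: const_mult mult.assoc const_left_commute[of p])

lemma finite_increasing_sequences: "finite (increasing_sequences n)"
proof (rule finite_subset)
  show "increasing_sequences n \<subseteq> {xs. set xs \<subseteq> {1..n} \<and> length xs \<le> n}"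
  proof safe
    fix xs assume "xs \<in> increasing_sequences n"
    then have "distinct xs" "set xs \<subseteq> {1..n}"
      by (auto simp: increasing_sequences_def strict_sorted_iff)
    then show "length xs \<le> n"
      using card_mono[of "{1..n}" "set xs"] by (simp add: distinct_card)
  qed (auto simp: increasing_sequences_def)
qed (rule finite_lists_length_le, simp)

abbreviation gen_prod :: "(nat \<Rightarrow> 'l) \<Rightarrow> nat list \<Rightarrow> ('l word \<Rightarrow>\<^sub>0 'k::field)"
  where "gen_prod x is \<equiv> prod_list (map (\<lambda>i. gen (x i)) is)"

lemma of_nat_prime_neq_0:
  assumes "prime p" "CHAR('k::field) \<noteq> p"
  shows "(of_nat p :: 'k) \<noteq> 0"
proof
  assume "(of_nat p :: 'k) = 0"
  then have "CHAR('k) dvd p"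
    using of_nat_eq_0_iff_char_dvd[of p, where 'a = 'k] by simp
  moreover have "CHAR('k) \<noteq> 1"
    using of_nat_CHAR[where 'a = 'k] by auto
  ultimately show False using assms by (auto simp: prime_nat_iff)
qed

context mock_lie_algebra
begin

definition env_cong :: "('l word \<Rightarrow>\<^sub>0 'k) \<Rightarrow> ('l word \<Rightarrow>\<^sub>0 'k) \<Rightarrow> bool" (infix "\<doteq>" 50)
  where "p \<doteq> q \<longleftrightarrow> p - q \<in> enveloping_kernel scale mul"

lemma env_cong_refl [simp]: "p \<doteq> p"
  by (simp add: env_cong_def enveloping_kernel.zero)

lemma env_cong_sym: "p \<doteq> q \<Longrightarrow> q \<doteq> p"
  using enveloping_kernel_uminus[of "p - q"] by (simp add: env_cong_def)

lemma env_cong_trans [trans]: "p \<doteq> q \<Longrightarrow> q \<doteq> r \<Longrightarrow> p \<doteq> r"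
  using enveloping_kernel.add[of "p - q" _ _ "q - r"] by (simp add: env_cong_def)

lemma env_cong_add: "p \<doteq> p' \<Longrightarrow> q \<doteq> q' \<Longrightarrow> p + q \<doteq> p' + q'"
  using enveloping_kernel.add[of "p - p'" _ _ "q - q'"] by (simp add: env_cong_def algebra_simps)

lemma env_cong_diff: "p \<doteq> p' \<Longrightarrow> q \<doteq> q' \<Longrightarrow> p - q \<doteq> p' - q'"
  using enveloping_kernel_minus[of "p - p'" _ _ "q - q'"] by (simp add: env_cong_def algebra_simps)

lemma env_cong_uminus: "p \<doteq> p' \<Longrightarrow> - p \<doteq> - p'"
  using env_cong_diff[of 0 0 p p'] by simp

lemma env_cong_mult_left: "q \<doteq> q' \<Longrightarrow> p * q \<doteq> p * q'"
  using enveloping_kernel_mult_left[of "q - q'" _ _ p] by (simp add: env_cong_def algebra_simps)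

lemma env_cong_mult_right: "p \<doteq> p' \<Longrightarrow> p * q \<doteq> p' * q"
  using enveloping_kernel_mult_right[of "p - p'" _ _ q] by (simp add: env_cong_def algebra_simps)

lemma env_cong_mult: "p \<doteq> p' \<Longrightarrow> q \<doteq> q' \<Longrightarrow> p * q \<doteq> p' * q'"
  by (meson env_cong_mult_left env_cong_mult_right env_cong_trans)

lemma env_cong_sum: "(\<And>i. i \<in> A \<Longrightarrow> f i \<doteq> g i) \<Longrightarrow> sum f A \<doteq> sum g A"
  by (induction A rule: infinite_finite_induct) (auto intro: env_cong_add)

lemma gen_add_cong: "gen (v + w) \<doteq> gen v + gen w"
  using enveloping_kernel.gen_add[of v w] by (simp add: env_cong_def diff_diff_eq)

lemma gen_scale_cong: "gen (scale c v) \<doteq> const c * gen v"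
  using enveloping_kernel.gen_scale by (simp add: env_cong_def)

lemma gen_zero_cong: "gen 0 \<doteq> 0"
  using gen_scale_cong[of 0 0] by simp

lemma gen_sum_cong: "gen (\<Sum>i\<in>A. f i) \<doteq> (\<Sum>i\<in>A. gen (f i))"
proof (induction A rule: infinite_finite_induct)
  case (insert i A)
  then show ?case
    using env_cong_trans[OF gen_add_cong env_cong_add[OF env_cong_refl insert.IH]] by simp
qed (simp_all add: gen_zero_cong)

lemma gen_lincomb_cong: "gen (\<Sum>i\<in>A. scale (a i) (f i)) \<doteq> (\<Sum>i\<in>A. const (a i) * gen (f i))"
  by (rule env_cong_trans[OF gen_sum_cong env_cong_sum]) (rule gen_scale_cong)

lemma mul_linear:
  "mul v (w + w') = mul v w + mul v w'" "mul v (scale c w) = scale c (mul v w)" "mul v 0 = 0"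
  using linear_right[of v, THEN Vector_Spaces.linear.axioms(3)]
  by (simp_all add: module_hom.add module_hom.scale module_hom.zero)

lemma gen_anticommutator:
  assumes "(2 :: 'k) \<noteq> 0"
  shows "gen v * gen w + gen w * gen v \<doteq> const 2 * gen (mul v w)"
proof -
  have "const 2 * (const (1/2) * (gen v * gen w + gen w * gen v)) \<doteq> const 2 * gen (mul v w)"
    using enveloping_kernel.gen_mul[of v w mul scale] by (intro env_cong_mult_left) (simp add: env_cong_def)
  moreover have "const 2 * (const (1/2) * p) = p" for p :: "'l word \<Rightarrow>\<^sub>0 'k"
    using assms by (simp add: mult_single flip: mult.assoc del: single_numeral)
  ultimately show ?thesis by simp
qed

lemma gen_square:
  assumes "(2 :: 'k) \<noteq> 0"
  shows "gen v * gen v \<doteq> gen (mul v v)"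
  using enveloping_kernel.gen_mul[of v v mul scale] by (simp add: env_cong_def const_half_double[OF assms])

section \<open>Linearly independent monomials force the product to vanish\<close>

text \<open>
  By commutativity the three terms of the Jacobi identity at \<open>v, v, v\<close> coincide.
\<close>

lemma cube_zero:
  assumes "(3 :: 'k) \<noteq> 0"
  shows "mul v (mul v v) = 0"
proof -
  have "mul (mul v v) v + mul (mul v v) v + mul (mul v v) v = scale 3 (mul (mul v v) v)"
    using scale_left_distrib[of 2 1] scale_left_distrib[of 1 1] by simp
  then have "scale 3 (mul (mul v v) v) = 0"
    using jacobi[of v v v] by simp
  then show ?thesis
    using assms by (simp add: commute)
qed

lemma env_cong_cancel_double:
  assumes "(2 :: 'k) \<noteq> 0" "p + p \<doteq> 0"
  shows "p \<doteq> 0"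
  using env_cong_mult_left[OF assms(2), of "const (1/2)"] by (simp add: const_half_double[OF assms(1)])

text \<open>
  The element \<open>v \<circ> v\<close> is the associative square of \<open>v\<close> in \<open>U(L)\<close>, so it commutes with \<open>v\<close>; because
  \<open>v \<circ> (v \<circ> v) = 0\<close>, it also anticommutes with \<open>v\<close>.
\<close>

lemma gen_mult_square:
  assumes two: "(2 :: 'k) \<noteq> 0" and three: "(3 :: 'k) \<noteq> 0"
  shows "gen v * gen (mul v v) \<doteq> 0" "gen (mul v v) * gen v \<doteq> 0"
proof -
  have "gen v * gen (mul v v) \<doteq> gen v * (gen v * gen v)"
    by (rule env_cong_mult_left[OF env_cong_sym[OF gen_square[OF two]]])
  also have "\<dots> = (gen v * gen v) * gen v"
    by (simp add: mult.assoc)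
  also have "\<dots> \<doteq> gen (mul v v) * gen v"
    by (rule env_cong_mult_right[OF gen_square[OF two]])
  finally have comm: "gen v * gen (mul v v) \<doteq> gen (mul v v) * gen v" .
  have "gen v * gen (mul v v) + gen v * gen (mul v v) \<doteq> gen v * gen (mul v v) + gen (mul v v) * gen v"
    using comm by (intro env_cong_add) simp_all
  also have "\<dots> \<doteq> const 2 * gen (mul v (mul v v))"
    by (rule gen_anticommutator[OF two])
  also have "\<dots> \<doteq> const 2 * 0"
    unfolding cube_zero[OF three] by (rule env_cong_mult_left[OF gen_zero_cong])
  finally have "gen v * gen (mul v v) + gen v * gen (mul v v) \<doteq> 0" by simp
  then show "gen v * gen (mul v v) \<doteq> 0"
    by (rule env_cong_cancel_double[OF two])
  then show "gen (mul v v) * gen v \<doteq> 0"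
    by (rule env_cong_trans[OF env_cong_sym[OF comm]])
qed

text \<open>
  If \<open>v \<circ> v = c v\<close>, then \<open>v \<circ> (v \<circ> v) = c\<^sup>2 v\<close>, which is zero by \<open>cube_zero\<close>. So every square
  vanishes, and the product is recovered from its squares by polarisation.
\<close>

lemma abelian_if_squares_proportional:
  assumes two: "(2 :: 'k) \<noteq> 0" and three: "(3 :: 'k) \<noteq> 0"
    and proportional: "\<And>v. v \<noteq> 0 \<Longrightarrow> \<exists>c. mul v v = scale c v"
  shows "abelian mul"
proof -
  have sq: "mul v v = 0" for v
  proof (cases "v = 0")
    case False
    then obtain c where c: "mul v v = scale c v" using proportional by blast
    have "scale c (scale c v) = 0"
      using cube_zero[OF three, of v] c by (simp add: mul_linear)
    then show ?thesis using c False by auto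
  qed (simp add: mul_linear)
  have "mul v w = 0" for v w
  proof -
    have "mul (v + w) (v + w) = mul v (v + w) + mul w (v + w)"
      by (simp only: mul_linear(1)[of "v + w" v w] commute[of "v + w" v] commute[of "v + w" w])
    also have "\<dots> = mul v v + mul v w + (mul v w + mul w w)"
      by (simp only: mul_linear(1) commute[of w v])
    finally have "mul (v + w) (v + w) = mul v v + mul v w + (mul v w + mul w w)" .
    then have "mul v w + mul v w = 0" by (simp add: sq)
    then have "scale 2 (mul v w) = 0"
      using scale_left_distrib[of 1 1] by simp
    then show ?thesis using two by simp
  qed
  then show ?thesis by (simp add: abelian_def)
qed

end

text \<open>
  Ordering a quadratic expression: an antisymmetric coefficient matrix has no diagonal part, and the
  terms below the diagonal pair up with those above it.
\<close>

lemma sum_antisymmetric: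
  fixes e :: "nat \<Rightarrow> nat \<Rightarrow> 'k::field" and g :: "nat \<Rightarrow> 'l word \<Rightarrow>\<^sub>0 'k"
  assumes A: "finite A" and skew: "\<And>i j. e j i = - e i j" and diag: "\<And>i. e i i = 0"
  shows "(\<Sum>i\<in>A. \<Sum>j\<in>A. const (e i j) * (g i * g j)) =
    (\<Sum>(i,j)\<in>{(i,j). i \<in> A \<and> j \<in> A \<and> i < j}. const (e i j) * (g i * g j - g j * g i))"
proof -
  define P where "P = {(i,j). i \<in> A \<and> j \<in> A \<and> i < j}"
  define h where "h = (\<lambda>(i,j). const (e i j) * (g i * g j))"
  have P: "finite P"
    by (rule finite_subset[of _ "A \<times> A"]) (auto simp: P_def A)
  have "(\<Sum>i\<in>A. \<Sum>j\<in>A. const (e i j) * (g i * g j)) = sum h (A \<times> A)"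
    by (simp add: sum.cartesian_product h_def)
  also have "\<dots> = sum h (P \<union> prod.swap ` P)"
    using A P
  proof (intro sum.mono_neutral_right ballI)
    fix z assume z: "z \<in> A \<times> A - (P \<union> prod.swap ` P)"
    obtain i j where ij: "z = (i, j)" by (cases z)
    have "i = j"
    proof (rule ccontr)
      assume "i \<noteq> j"
      then have "(i, j) \<in> P \<or> (j, i) \<in> P"
        using z ij by (auto simp: P_def)
      then show False using z ij by (metis DiffE UnCI imageI swap_simp)
    qed
    then show "h z = 0" by (simp add: ij h_def diag)
  qed (auto simp: P_def)
  also have "\<dots> = sum h P + sum h (prod.swap ` P)"
    using P by (intro sum.union_disjoint) (auto simp: P_def)
  also have "sum h (prod.swap ` P) = (\<Sum>(i,j)\<in>P. h (j, i))"
    by (subst sum.reindex) (auto intro!: sum.cong)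
  also have "sum h P + (\<Sum>(i,j)\<in>P. h (j, i)) =
      (\<Sum>(i,j)\<in>P. const (e i j) * (g i * g j - g j * g i))"
    unfolding sum.distrib[symmetric]
    by (intro sum.cong refl) (auto simp: h_def skew[of _ "fst _"] split_beta algebra_simps single_uminus)
  finally show ?thesis by (simp add: P_def)
qed

context mock_lie_algebra
begin

lemma gen_mult_lincomb:
  "gen (\<Sum>i\<in>A. scale (a i) (x i)) * gen (\<Sum>j\<in>A. scale (b j) (x j)) \<doteq>
    (\<Sum>i\<in>A. \<Sum>j\<in>A. const (a i * b j) * (gen (x i) * gen (x j)))"
proof -
  have "gen (\<Sum>i\<in>A. scale (a i) (x i)) * gen (\<Sum>j\<in>A. scale (b j) (x j)) \<doteq>
      (\<Sum>i\<in>A. const (a i) * gen (x i)) * (\<Sum>j\<in>A. const (b j) * gen (x j))"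
    by (intro env_cong_mult gen_lincomb_cong)
  also have "\<dots> = (\<Sum>i\<in>A. \<Sum>j\<in>A. const (a i * b j) * (gen (x i) * gen (x j)))"
    by (simp only: sum_product const_mult_mult)
  finally show ?thesis .
qed

text \<open>
  The ordered form of a commutator: \<open>w v\<close> is replaced by \<open>2 (v \<circ> w) - v w\<close>.
\<close>

lemma gen_commutator:
  assumes "(2 :: 'k) \<noteq> 0"
  shows "gen v * gen w - gen w * gen v \<doteq> const 2 * (gen v * gen w) - const 2 * gen (mul v w)"
proof -
  have "const 2 * (gen v * gen w) - (gen v * gen w + gen w * gen v) \<doteq> const 2 * (gen v * gen w) - const 2 * gen (mul v w)"
    by (intro env_cong_diff env_cong_refl gen_anticommutator assms)
  moreover have "const 2 * p - (p + q) = p - q" for p q :: "'l word \<Rightarrow>\<^sub>0 'k"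
    by (simp add: mult_2)
  ultimately show ?thesis by (simp only:)
qed

text \<open>
  The coordinates of \<open>v\<close> and of \<open>v \<circ> v\<close> form a matrix with two rows, and its \<open>2 \<times> 2\<close> minors are,
  up to the factor 2, the coefficients of the monomials of length two in the ordered form of the
  commutator of \<open>v\<close> and \<open>v \<circ> v\<close>. That commutator is zero by \<open>gen_mult_square\<close>, so the minors vanish
  and the rows are proportional.
\<close>

lemma square_proportional:
  fixes x :: "nat \<Rightarrow> 'l"
  assumes two: "(2 :: 'k) \<noteq> 0" and three: "(3 :: 'k) \<noteq> 0"
    and gens: "\<And>v. \<exists>a. v = (\<Sum>i\<in>{1..n}. scale (a i) (x i))"
    and indep: "\<And>c. (\<Sum>s\<in>increasing_sequences n. const (c s) * gen_prod x s) \<in> enveloping_kernel scale mul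
      \<Longrightarrow> \<forall>s\<in>increasing_sequences n. c s = 0"
    and v: "v \<noteq> 0"
  shows "\<exists>c. mul v v = scale c v"
proof -
  let ?A = "{1..n}" and ?S = "increasing_sequences n"
  let ?g = "\<lambda>i. gen (x i) :: 'l word \<Rightarrow>\<^sub>0 'k"
  obtain a where a: "v = (\<Sum>i\<in>?A. scale (a i) (x i))" using gens by blast
  obtain b where b: "mul v v = (\<Sum>i\<in>?A. scale (b i) (x i))" using gens by blast
  define e where "e i j = a i * b j - a j * b i" for i j
  define P where "P = {(i,j). i \<in> ?A \<and> j \<in> ?A \<and> i < j}"
  have P: "finite P"
    by (rule finite_subset[of _ "?A \<times> ?A"]) (auto simp: P_def)
  have "gen v * gen (mul v v) - gen (mul v v) * gen v \<doteq> 0 - 0"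
    by (intro env_cong_diff gen_mult_square two three)
  then have "gen v * gen (mul v v) - gen (mul v v) * gen v \<doteq> 0"
    by simp
  moreover have "gen v * gen (mul v v) - gen (mul v v) * gen v \<doteq>
      (\<Sum>i\<in>?A. \<Sum>j\<in>?A. const (a i * b j) * (?g i * ?g j)) -
      (\<Sum>i\<in>?A. \<Sum>j\<in>?A. const (b i * a j) * (?g i * ?g j))"
    using gen_mult_lincomb[of a x ?A b] gen_mult_lincomb[of b x ?A a]
    unfolding a[symmetric] b[symmetric] by (rule env_cong_diff)
  ultimately have "(\<Sum>i\<in>?A. \<Sum>j\<in>?A. const (a i * b j) * (?g i * ?g j)) -
      (\<Sum>i\<in>?A. \<Sum>j\<in>?A. const (b i * a j) * (?g i * ?g j)) \<doteq> 0"
    by (blast intro: env_cong_sym env_cong_trans)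
  also have "(\<Sum>i\<in>?A. \<Sum>j\<in>?A. const (a i * b j) * (?g i * ?g j)) -
      (\<Sum>i\<in>?A. \<Sum>j\<in>?A. const (b i * a j) * (?g i * ?g j)) =
      (\<Sum>i\<in>?A. \<Sum>j\<in>?A. const (e i j) * (?g i * ?g j))"
    unfolding sum_subtractf[symmetric] e_def
    by (intro sum.cong refl) (simp add: single_diff left_diff_distrib mult.commute[of "b _" "a _"])
  also have "\<dots> = (\<Sum>(i,j)\<in>P. const (e i j) * (?g i * ?g j - ?g j * ?g i))"
    unfolding P_def by (rule sum_antisymmetric) (simp_all add: e_def)
  finally have 0: "(\<Sum>(i,j)\<in>P. const (e i j) * (?g i * ?g j - ?g j * ?g i)) \<doteq> 0" .
  \<comment> \<open>Ordering the products leaves only terms that are linear in \<open>L\<close>; they are collected in one element.\<close>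
  define z where "z = (\<Sum>q\<in>P. scale (2 * e (fst q) (snd q)) (mul (x (fst q)) (x (snd q))))"
  obtain c where c: "z = (\<Sum>i\<in>?A. scale (c i) (x i))" using gens by blast
  have "(\<Sum>(i,j)\<in>P. const (e i j) * (?g i * ?g j - ?g j * ?g i)) \<doteq>
      (\<Sum>(i,j)\<in>P. const (e i j) * (const 2 * (?g i * ?g j) - const 2 * gen (mul (x i) (x j))))"
    unfolding split_beta
    by (intro env_cong_sum env_cong_mult_left gen_commutator two)
  also have "\<dots> = (\<Sum>(i,j)\<in>P. const (2 * e i j) * (?g i * ?g j)) -
      (\<Sum>q\<in>P. const (2 * e (fst q) (snd q)) * gen (mul (x (fst q)) (x (snd q))))"
    unfolding split_beta sum_subtractf[symmetric]
    by (intro sum.cong refl)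
       (simp only: right_diff_distrib mult.commute[of 2] const_mult mult.assoc)
  also have "\<dots> \<doteq> (\<Sum>(i,j)\<in>P. const (2 * e i j) * (?g i * ?g j)) - (\<Sum>i\<in>?A. const (c i) * ?g i)"
  proof (intro env_cong_diff env_cong_refl)
    have "(\<Sum>q\<in>P. const (2 * e (fst q) (snd q)) * gen (mul (x (fst q)) (x (snd q)))) \<doteq> gen z"
      unfolding z_def by (rule env_cong_sym[OF gen_lincomb_cong])
    also have "gen z \<doteq> (\<Sum>i\<in>?A. const (c i) * ?g i)"
      unfolding c by (rule gen_lincomb_cong)
    finally show "(\<Sum>q\<in>P. const (2 * e (fst q) (snd q)) * gen (mul (x (fst q)) (x (snd q)))) \<doteq>
      (\<Sum>i\<in>?A. const (c i) * ?g i)" .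
  qed
  finally have 1: "(\<Sum>(i,j)\<in>P. const (2 * e i j) * (?g i * ?g j)) - (\<Sum>i\<in>?A. const (c i) * ?g i) \<doteq> 0"
    using 0 by (blast intro: env_cong_sym env_cong_trans)
  \<comment> \<open>The coefficients of the ordered expression: linear terms and products of two factors.\<close>
  define C where "C s = (case s of [i] \<Rightarrow> - c i | [i,j] \<Rightarrow> 2 * e i j | _ \<Rightarrow> 0)" for s
  let ?pair = "\<lambda>(i,j). [i,j]" and ?single = "\<lambda>i. [i]"
  have "(\<Sum>s\<in>?S. const (C s) * gen_prod x s) = (\<Sum>s\<in>?pair ` P \<union> ?single ` ?A. const (C s) * gen_prod x s)"
  proof (intro sum.mono_neutral_right ballI)
    show "?pair ` P \<union> ?single ` ?A \<subseteq> ?S"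
      by (auto simp: P_def increasing_sequences_def)
    fix s assume s: "s \<in> ?S - (?pair ` P \<union> ?single ` ?A)"
    show "const (C s) * gen_prod x s = 0"
    proof (cases s rule: list.exhaust[case_names Nil Cons])
      case (Cons i s')
      then show ?thesis
      proof (cases s' rule: list.exhaust[case_names Nil Cons])
        case (Cons j s'')
        then show ?thesis
          using \<open>s = i # s'\<close> s by (cases s'') (auto simp: C_def P_def increasing_sequences_def image_iff)
      qed (use s in \<open>auto simp: increasing_sequences_def\<close>)
    qed (simp add: C_def)
  qed (rule finite_increasing_sequences)
  also have "\<dots> = (\<Sum>s\<in>?pair ` P. const (C s) * gen_prod x s) + (\<Sum>s\<in>?single ` ?A. const (C s) * gen_prod x s)"
    using P by (intro sum.union_disjoint) auto
  also have "(\<Sum>s\<in>?pair ` P. const (C s) * gen_prod x s) = (\<Sum>(i,j)\<in>P. const (2 * e i j) * (?g i * ?g j))"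
    by (subst sum.reindex) (auto intro!: sum.cong inj_onI simp: C_def)
  also have "(\<Sum>s\<in>?single ` ?A. const (C s) * gen_prod x s) = - (\<Sum>i\<in>?A. const (c i) * ?g i)"
    by (subst sum.reindex) (auto simp: C_def single_uminus sum_negf intro!: inj_onI)
  finally have "(\<Sum>s\<in>?S. const (C s) * gen_prod x s) \<in> enveloping_kernel scale mul"
    using 1 by (simp add: env_cong_def)
  then have C: "C s = 0" if "s \<in> ?S" for s
    using indep that by blast
  have e: "e i j = 0" if "i \<in> ?A" "j \<in> ?A" "i < j" for i j
    using C[of "[i,j]"] that two by (auto simp: C_def increasing_sequences_def)
  have ab: "a i * b j = a j * b i" if "i \<in> ?A" "j \<in> ?A" for i j
    using e[OF that] e[OF that(2,1)] by (cases i j rule: linorder_cases) (auto simp: e_def)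
  have "\<exists>i\<in>?A. a i \<noteq> 0"
  proof (rule ccontr)
    assume "\<not> ?thesis"
    then have "v = 0" unfolding a by (intro sum.neutral) auto
    then show False using v by blast
  qed
  then obtain i where i: "i \<in> ?A" "a i \<noteq> 0" by blast
  have "mul v v = (\<Sum>j\<in>?A. scale (b i / a i) (scale (a j) (x j)))"
    unfolding b
  proof (rule sum.cong[OF refl])
    fix j assume "j \<in> ?A"
    then have "b j = b i / a i * a j"
      using ab[OF i(1)] i(2) by (simp add: field_simps)
    then show "scale (b j) (x j) = scale (b i / a i) (scale (a j) (x j))"
      by simp
  qed
  also have "\<dots> = scale (b i / a i) v"
    unfolding a by (rule scale_sum_right[symmetric])
  finally show ?thesis by blast
qed

end

context mock_lie_algebra
begin

section \<open>In the abelian case the monomials span\<close>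

text \<open>
  The new factor is moved to its place by anticommutation, which costs a sign; if it meets an equal
  factor, the product is zero and \<open>c = 0\<close>.
\<close>

lemma gen_mult_gen_prod:
  assumes two: "(2 :: 'k) \<noteq> 0" and ab: "abelian mul" and s: "sorted_wrt (<) s"
  shows "\<exists>t c. sorted_wrt (<) t \<and> set t = insert i (set s) \<and>
    gen (x i) * gen_prod x s \<doteq> const c * gen_prod x t"
  using s
proof (induction s)
  case Nil
  show ?case
    by (intro exI[of _ "[i]"] exI[of _ 1]) simp
next
  case (Cons j s)
  consider "i < j" | "i = j" | "j < i" by linarith
  then show ?case
  proof cases
    case 1
    then show ?thesis
      using Cons.prems by (intro exI[of _ "i # j # s"] exI[of _ 1]) (auto intro: less_trans)
  next
    case 2
    have "gen (x i) * gen (x i) \<doteq> 0"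
      using env_cong_trans[OF gen_square[OF two, of "x i"], of 0] gen_zero_cong ab
      by (simp add: abelian_def)
    then have "gen (x i) * gen (x i) * gen_prod x s \<doteq> 0 * gen_prod x s"
      by (rule env_cong_mult_right)
    then show ?thesis
      using Cons.prems 2 by (intro exI[of _ "j # s"] exI[of _ 0]) (auto simp: mult.assoc)
  next
    case 3
    obtain t c where t: "sorted_wrt (<) t" "set t = insert i (set s)"
      "gen (x i) * gen_prod x s \<doteq> const c * gen_prod x t"
      using Cons by auto
    have "gen (x i) * gen (x j) + gen (x j) * gen (x i) \<doteq> const 2 * gen 0"
      using gen_anticommutator[OF two, of "x i" "x j"] ab by (simp add: abelian_def)
    also have "\<dots> \<doteq> const 2 * 0"
      by (rule env_cong_mult_left[OF gen_zero_cong])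
    finally have "gen (x i) * gen (x j) + gen (x j) * gen (x i) - gen (x j) * gen (x i) \<doteq> 0 - gen (x j) * gen (x i)"
      by (intro env_cong_diff) simp_all
    then have "gen (x i) * gen (x j) \<doteq> - (gen (x j) * gen (x i))"
      by simp
    then have "gen (x i) * gen (x j) * gen_prod x s \<doteq> - (gen (x j) * gen (x i)) * gen_prod x s"
      by (rule env_cong_mult_right)
    also have "\<dots> = - (gen (x j) * (gen (x i) * gen_prod x s))"
      by (simp add: mult.assoc)
    also have "\<dots> \<doteq> - (gen (x j) * (const c * gen_prod x t))"
      by (intro env_cong_uminus env_cong_mult_left t)
    also have "\<dots> = const (- c) * gen_prod x (j # t)"
      by (simp add: const_left_commute[of "gen (x j)"] single_uminus)
    finally show ?thesis
      using t Cons.prems 3 by (intro exI[of _ "j # t"] exI[of _ "- c"]) (auto simp: mult.assoc)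
  qed
qed

text \<open>
  The span of the ordered monomials contains 1 and is stable under left multiplication by the
  elements of \<open>L\<close>, hence contains every word.
\<close>

lemma increasing_products_span:
  fixes x :: "nat \<Rightarrow> 'l"
  assumes two: "(2 :: 'k) \<noteq> 0" and ab: "abelian mul"
    and gens: "\<And>v. \<exists>a. v = (\<Sum>i\<in>{1..n}. scale (a i) (x i))"
  shows "\<exists>c. p \<doteq> (\<Sum>s\<in>increasing_sequences n. const (c s) * gen_prod x s)"
proof -
  let ?S = "increasing_sequences n"
  define M where "M = {p. \<exists>c. p \<doteq> (\<Sum>s\<in>?S. const (c s) * gen_prod x s)}"
  have cong: "p \<in> M" if "p \<doteq> q" "q \<in> M" for p q
    using that env_cong_trans unfolding M_def by blast
  have add: "p + q \<in> M" if pq: "p \<in> M" "q \<in> M" for p q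
  proof -
    obtain c d where "p \<doteq> (\<Sum>s\<in>?S. const (c s) * gen_prod x s)" "q \<doteq> (\<Sum>s\<in>?S. const (d s) * gen_prod x s)"
      using pq by (auto simp: M_def)
    then have "p + q \<doteq> (\<Sum>s\<in>?S. const (c s) * gen_prod x s) + (\<Sum>s\<in>?S. const (d s) * gen_prod x s)"
      by (rule env_cong_add)
    also have "\<dots> = (\<Sum>s\<in>?S. const (c s + d s) * gen_prod x s)"
      by (simp add: single_add distrib_right sum.distrib)
    finally show ?thesis by (auto simp: M_def)
  qed
  have const: "const c * p \<in> M" if p: "p \<in> M" for c p
  proof -
    obtain d where "p \<doteq> (\<Sum>s\<in>?S. const (d s) * gen_prod x s)"
      using p by (auto simp: M_def)
    then have "const c * p \<doteq> const c * (\<Sum>s\<in>?S. const (d s) * gen_prod x s)"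
      by (rule env_cong_mult_left)
    also have "\<dots> = (\<Sum>s\<in>?S. const (c * d s) * gen_prod x s)"
      by (simp only: sum_distrib_left const_mult mult.assoc)
    finally show ?thesis by (auto simp: M_def)
  qed
  have zero: "0 \<in> M"
    by (auto simp: M_def intro!: exI[of _ "\<lambda>_. 0"])
  have sum: "sum f A \<in> M" if "\<And>i. i \<in> A \<Longrightarrow> f i \<in> M" for f :: "'z \<Rightarrow> _" and A
    using that by (induction A rule: infinite_finite_induct) (auto intro: add zero)
  have gen_prod: "gen_prod x t \<in> M" if "t \<in> ?S" for t
  proof -
    have "(\<Sum>s\<in>?S. const (if s = t then 1 else 0 :: 'k) * gen_prod x s) =
        (\<Sum>s\<in>?S. if s = t then gen_prod x s else 0)"
      by (intro sum.cong) auto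
    also have "\<dots> = gen_prod x t"
      using that by (simp add: finite_increasing_sequences)
    finally have "gen_prod x t \<doteq> (\<Sum>s\<in>?S. const (if s = t then 1 else 0) * gen_prod x s)"
      by (simp only: env_cong_refl)
    then show ?thesis
      unfolding M_def by (intro CollectI exI[of _ "\<lambda>s. if s = t then 1 else 0"])
  qed
  have basis: "gen (x i) * gen_prod x s \<in> M" if "i \<in> {1..n}" "s \<in> ?S" for i s
  proof -
    have "sorted_wrt (<) s" using that by (simp add: increasing_sequences_def)
    from gen_mult_gen_prod[OF two ab this, of i x] obtain t c
      where "sorted_wrt (<) t" "set t = insert i (set s)"
        "gen (x i) * gen_prod x s \<doteq> const c * gen_prod x t" by blast
    moreover from this have "t \<in> ?S" using that by (auto simp: increasing_sequences_def)
    ultimately show ?thesis using cong const gen_prod by blast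
  qed
  have gen: "gen v * p \<in> M" if p: "p \<in> M" for v p
  proof -
    obtain d where d: "p \<doteq> (\<Sum>s\<in>?S. const (d s) * gen_prod x s)"
      using p by (auto simp: M_def)
    obtain a where a: "v = (\<Sum>i\<in>{1..n}. scale (a i) (x i))" using gens by blast
    have "gen v * p \<doteq> (\<Sum>i\<in>{1..n}. const (a i) * gen (x i)) * (\<Sum>s\<in>?S. const (d s) * gen_prod x s)"
      unfolding a by (intro env_cong_mult d gen_lincomb_cong)
    moreover have "\<dots> = (\<Sum>i\<in>{1..n}. \<Sum>s\<in>?S. const (a i * d s) * (gen (x i) * gen_prod x s))"
      by (simp only: sum_product const_mult_mult)
    moreover have "\<dots> \<in> M"
      by (intro sum const basis)
    ultimately show ?thesis using cong by simp
  qed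
  have "Poly_Mapping.single w c \<in> M" for w c
  proof (cases w)
    case (Word vs)
    have "Poly_Mapping.single (Word vs) c \<in> M"
    proof (induction vs)
      case Nil
      have "const c * gen_prod x [] \<in> M"
        by (intro const gen_prod) (simp add: increasing_sequences_def)
      then show ?case by (simp add: zero_word_def)
    next
      case (Cons v vs)
      have "Poly_Mapping.single (Word (v # vs)) c = gen v * Poly_Mapping.single (Word vs) c"
        by (simp add: gen_def mult_single plus_word_def)
      then show ?case using gen[OF Cons] by simp
    qed
    then show ?thesis using Word by simp
  qed
  then have "p \<in> M"
    by (induction p rule: poly_mapping_additive_induct) (auto intro: add)
  then show ?thesis by (simp add: M_def)
qed

end

section \<open>Modules over the free algebra and the enveloping algebra\<close>

text \<open>
  Operators on functions with values in the field are general enough here: the exterior algebra is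
  realised below by functions of a set of indices.
\<close>

definition linear_action :: "('v \<Rightarrow> ('a \<Rightarrow> 'k::field) \<Rightarrow> 'a \<Rightarrow> 'k) \<Rightarrow> bool"
  where "linear_action E \<longleftrightarrow>
    (\<forall>v f g. E v (\<lambda>a. f a + g a) = (\<lambda>a. E v f a + E v g a)) \<and>
    (\<forall>v c f. E v (\<lambda>a. c * f a) = (\<lambda>a. c * E v f a))"

text \<open>
  The module structure over the free algebra that extends the operators \<open>E v\<close>: a word acts as the
  composition of its letters.
\<close>

definition free_action ::
    "('v \<Rightarrow> ('a \<Rightarrow> 'k::field) \<Rightarrow> 'a \<Rightarrow> 'k) \<Rightarrow> ('v word \<Rightarrow>\<^sub>0 'k) \<Rightarrow> ('a \<Rightarrow> 'k) \<Rightarrow> 'a \<Rightarrow> 'k"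
  where "free_action E p f a = (\<Sum>w\<in>Poly_Mapping.keys p. Poly_Mapping.lookup p w * foldr E (letters w) f a)"

lemma free_action_superset:
  assumes "finite W" "Poly_Mapping.keys p \<subseteq> W"
  shows "free_action E p f a = (\<Sum>w\<in>W. Poly_Mapping.lookup p w * foldr E (letters w) f a)"
  unfolding free_action_def using assms
  by (intro sum.mono_neutral_left) (auto simp: in_keys_iff)

lemma free_action_single: "free_action E (Poly_Mapping.single w c) f = (\<lambda>a. c * foldr E (letters w) f a)"
  by (rule ext) (simp add: free_action_superset[of "{w}"])

lemma free_action_add: "free_action E (p + q) f = (\<lambda>a. free_action E p f a + free_action E q f a)"
proof
  fix a
  let ?W = "Poly_Mapping.keys p \<union> Poly_Mapping.keys q"
  show "free_action E (p + q) f a = free_action E p f a + free_action E q f a"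
    using Poly_Mapping.keys_add[of p q]
    by (simp add: free_action_superset[of ?W] lookup_add distrib_right sum.distrib)
qed

lemma foldr_linear_action:
  assumes "linear_action E"
  shows "foldr E vs (\<lambda>a. f a + g a) = (\<lambda>a. foldr E vs f a + foldr E vs g a)"
    and "foldr E vs (\<lambda>a. c * f a) = (\<lambda>a. c * foldr E vs f a)"
  using assms by (induction vs) (simp_all add: linear_action_def)

lemma free_action_linear:
  assumes "linear_action E"
  shows "free_action E p (\<lambda>a. f a + g a) = (\<lambda>a. free_action E p f a + free_action E p g a)"
    and "free_action E p (\<lambda>a. c * f a) = (\<lambda>a. c * free_action E p f a)"
  by (auto simp: fun_eq_iff free_action_def foldr_linear_action[OF assms] distrib_left sum.distrib
      sum_distrib_left mult.left_commute)

lemma free_action_mult: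
  assumes "linear_action E"
  shows "free_action E (p * q) f = free_action E p (free_action E q f)"
proof (induction p rule: poly_mapping_additive_induct)
  case (1 u c)
  show ?case
  proof (induction q rule: poly_mapping_additive_induct)
    case (1 v d)
    then show ?case
      by (simp add: mult_single plus_word_def free_action_single foldr_linear_action[OF assms] mult.assoc)
  next
    case (2 p q)
    then show ?case
      by (simp add: distrib_left free_action_add free_action_linear[OF assms])
  qed
next
  case (2 p q)
  then show ?case
    by (simp add: distrib_right free_action_add)
qed

lemma free_action_gen: "free_action E (gen v) f = E v f"
  by (simp add: gen_def free_action_single)

lemma free_action_const: "free_action E (const c) f = (\<lambda>a. c * f a)"
  by (simp add: free_action_single zero_word_def)

lemma free_action_diff: "free_action E (p - q) f = (\<lambda>a. free_action E p f a - free_action E q f a)"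
  using free_action_add[of E "p - q" q f] by (simp add: fun_eq_iff)

text \<open>
  The universal property of \<open>U(L)\<close>: operators that depend linearly on \<open>v\<close> and satisfy the defining
  relations of \<open>U(L)\<close> make the function space a \<open>U(L)\<close>-module. This is the source of lower bounds on
  \<open>U(L)\<close>: whatever acts nontrivially is nonzero.
\<close>

lemma enveloping_kernel_acts_trivially:
  fixes scale :: "'k::field \<Rightarrow> 'l::ab_group_add \<Rightarrow> 'l" and E :: "'l \<Rightarrow> ('a \<Rightarrow> 'k) \<Rightarrow> 'a \<Rightarrow> 'k"
  assumes E: "linear_action E"
    and E_add: "\<And>v w f a. E (v + w) f a = E v f a + E w f a"
    and E_scale: "\<And>c v f a. E (scale c v) f a = c * E v f a"
    and E_mul: "\<And>v w f a. 1/2 * (E v (E w f) a + E w (E v f) a) = E (mul v w) f a"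
    and p: "p \<in> enveloping_kernel scale mul"
  shows "free_action E p f = (\<lambda>a. 0)"
  using p
proof (induction arbitrary: f)
  case zero
  show ?case by (simp add: free_action_def fun_eq_iff)
next
  case (add p q)
  then show ?case by (simp add: free_action_add)
next
  case (mult p q r)
  have "free_action E q (\<lambda>a. 0) = (\<lambda>a. 0)"
    using free_action_linear(2)[OF E, of q 0] by simp
  then show ?case by (simp add: free_action_mult[OF E] mult)
next
  case (gen_add v w)
  show ?case by (simp add: free_action_diff free_action_gen E_add)
next
  case (gen_scale c v)
  show ?case by (simp add: free_action_diff free_action_mult[OF E] free_action_const free_action_gen E_scale)
next
  case (gen_mul v w)
  show ?case
    by (simp only: free_action_diff free_action_mult[OF E] free_action_const free_action_gen free_action_add E_mul) simp
qed

section \<open>Exterior multiplication and independence in the abelian case\<close>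

text \<open>
  Left multiplication by the vector with coordinates \<open>\<xi>\<close> in the exterior algebra, where the value of \<open>f\<close> at \<open>S\<close> is
  the coefficient of the wedge product of the elements of \<open>S\<close> in increasing order. The sign moves \<open>i\<close>
  past the smaller elements of \<open>S\<close>. At an infinite \<open>S\<close> the sum is 0 by convention, which keeps the
  operator total and linear.
\<close>

definition wedge :: "(nat \<Rightarrow> 'k::field) \<Rightarrow> (nat set \<Rightarrow> 'k) \<Rightarrow> nat set \<Rightarrow> 'k"
  where "wedge \<xi> f S = (\<Sum>i\<in>S. \<xi> i * (-1) ^ card {j\<in>S. j < i} * f (S - {i}))"

lemma sum_pairs_swap:
  assumes "finite S"
  shows "(\<Sum>i\<in>S. \<Sum>j\<in>S - {i}. h i j) = (\<Sum>i\<in>S. \<Sum>j\<in>S - {i}. h j i)"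
proof -
  have "(\<Sum>i\<in>S. \<Sum>j\<in>{j\<in>S. i \<noteq> j}. h i j) = (\<Sum>j\<in>S. \<Sum>i\<in>{i\<in>S. i \<noteq> j}. h i j)"
    using assms assms by (rule sum.swap_restrict)
  moreover have "{j\<in>S. i \<noteq> j} = S - {i}" "{j\<in>S. j \<noteq> i} = S - {i}" for i by auto
  ultimately show ?thesis by simp
qed

text \<open>
  In \<open>\<sigma> i j\<close>, the sign with which \<open>i\<close> and then \<open>j\<close> are split off from \<open>S\<close>, the order matters only
  for the larger of the two, which has one smaller element less once the other has been removed.
\<close>

lemma wedge_anticommute: "wedge \<xi> (wedge \<eta> f) S + wedge \<eta> (wedge \<xi> f) S = 0"
proof (cases "finite S")
  case True
  define \<sigma> :: "nat \<Rightarrow> nat \<Rightarrow> 'a" where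
    "\<sigma> i j = (-1) ^ card {k\<in>S. k < i} * (-1) ^ card {k\<in>S - {i}. k < j}" for i j
  have less: "\<sigma> i j + \<sigma> j i = 0" if "i \<in> S" "j \<in> S" "i < j" for i j
  proof -
    have "{k\<in>S. k < j} = insert i {k\<in>S - {i}. k < j}"
      using that by auto
    then have "card {k\<in>S. k < j} = Suc (card {k\<in>S - {i}. k < j})"
      using True by simp
    moreover have "{k\<in>S - {j}. k < i} = {k\<in>S. k < i}"
      using that by auto
    ultimately show ?thesis by (simp add: \<sigma>_def mult.commute)
  qed
  have sign: "\<sigma> i j + \<sigma> j i = 0" if "i \<in> S" "j \<in> S - {i}" for i j
    using less[of i j] less[of j i] that by (cases i j rule: linorder_cases) (auto simp: add.commute)
  have expand: "wedge \<xi> (wedge \<eta> f) S = (\<Sum>i\<in>S. \<Sum>j\<in>S - {i}. \<xi> i * \<eta> j * \<sigma> i j * f (S - {i} - {j}))" for \<xi> \<eta>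
    unfolding wedge_def sum_distrib_left
    by (intro sum.cong refl) (simp only: \<sigma>_def mult_ac)
  have "wedge \<xi> (wedge \<eta> f) S + wedge \<eta> (wedge \<xi> f) S =
      (\<Sum>i\<in>S. \<Sum>j\<in>S - {i}. \<xi> i * \<eta> j * \<sigma> i j * f (S - {i} - {j}) + \<eta> j * \<xi> i * \<sigma> j i * f (S - {j} - {i}))"
    unfolding expand sum.distrib
    by (subst (2) sum_pairs_swap[OF True]) (rule refl)
  also have "\<dots> = 0"
  proof (intro sum.neutral ballI)
    fix i j assume ij: "i \<in> S" "j \<in> S - {i}"
    have "S - {j} - {i} = S - {i} - {j}" by blast
    then have "\<xi> i * \<eta> j * \<sigma> i j * f (S - {i} - {j}) + \<eta> j * \<xi> i * \<sigma> j i * f (S - {j} - {i}) =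
        \<xi> i * \<eta> j * f (S - {i} - {j}) * (\<sigma> i j + \<sigma> j i)"
      by (simp add: algebra_simps)
    then show "\<xi> i * \<eta> j * \<sigma> i j * f (S - {i} - {j}) + \<eta> j * \<xi> i * \<sigma> j i * f (S - {j} - {i}) = 0"
      using sign[OF ij] by simp
  qed
  finally show ?thesis .
qed (simp add: wedge_def)

lemma linear_action_wedge: "linear_action (\<lambda>v. wedge (\<xi> v))"
  unfolding linear_action_def wedge_def
  by (simp add: distrib_left sum.distrib sum_distrib_left mult.left_commute)

text \<open>
  No sign appears, because the new factor precedes all elements of \<open>S\<close>.
\<close>

lemma wedge_unit:
  assumes fin: "finite S" and i: "\<And>j. j \<in> S \<Longrightarrow> i < j"
  shows "wedge (\<lambda>j. if j = i then 1 else 0) (\<lambda>T. if T = S then 1 else 0) =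
    (\<lambda>T. if T = insert i S then 1 else (0 :: 'k::field))"
proof
  fix T :: "nat set"
  have "wedge (\<lambda>j. if j = i then 1 else 0) (\<lambda>T. if T = S then 1 else (0 :: 'k)) T =
      (\<Sum>j\<in>T. if j = i then (-1) ^ card {j\<in>T. j < i} * (if T - {i} = S then 1 else 0) else 0)"
    unfolding wedge_def by (intro sum.cong) auto
  also have "\<dots> = (if T = insert i S then 1 else 0)"
  proof (cases "T = insert i S")
    case True
    have "{j\<in>T. j < i} = {}" "T - {i} = S"
      using i True by (force dest: less_asym)+
    then show ?thesis unfolding \<open>{j\<in>T. j < i} = {}\<close> using fin True by simp
  next
    case False
    then have "T - {i} \<noteq> S" if "i \<in> T" using that by blast
    then show ?thesis using False by (intro trans[OF sum.neutral]) auto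
  qed
  finally show "wedge (\<lambda>j. if j = i then 1 else 0) (\<lambda>T. if T = S then 1 else 0) T =
    (if T = insert i S then 1 else (0 :: 'k))" .
qed

context mock_lie_algebra
begin

text \<open>
  Applied to the indicator of the empty set, the monomial of \<open>s\<close> gives the indicator \<open>\<delta> (set s)\<close>,
  and an increasing sequence is determined by the set of its entries. Evaluating a vanishing
  combination at \<open>set t\<close> therefore isolates the coefficient of \<open>t\<close>.
\<close>

lemma increasing_products_independent:
  fixes x :: "nat \<Rightarrow> 'l" and coord :: "'l \<Rightarrow> nat \<Rightarrow> 'k"
  assumes ab: "abelian mul"
    and coord_add: "\<And>v w i. coord (v + w) i = coord v i + coord w i"
    and coord_scale: "\<And>c v i. coord (scale c v) i = c * coord v i"
    and coord_basis: "\<And>j. j \<in> {1..n} \<Longrightarrow> coord (x j) = (\<lambda>i. if i = j then 1 else 0)"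
    and c: "(\<Sum>s\<in>increasing_sequences n. const (c s) * gen_prod x s) \<in> enveloping_kernel scale mul"
    and t: "t \<in> increasing_sequences n"
  shows "c t = 0"
proof -
  let ?S = "increasing_sequences n"
  define E where "E v = wedge (coord v)" for v
  define \<delta> :: "nat set \<Rightarrow> nat set \<Rightarrow> 'k" where "\<delta> S = (\<lambda>T. if T = S then 1 else 0)" for S
  have E: "linear_action E"
    unfolding E_def by (rule linear_action_wedge)
  have E_add: "E (v + w) f S = E v f S + E w f S" for v w f S
    by (simp add: E_def wedge_def coord_add distrib_right sum.distrib)
  have E_scale: "E (scale c v) f S = c * E v f S" for c v f S
    by (simp add: E_def wedge_def coord_scale sum_distrib_left mult.assoc)
  have "E 0 f S = 0" for f S
    using E_scale[of 0 0 f S] by simp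
  then have E_mul: "1/2 * (E v (E w f) S + E w (E v f) S) = E (mul v w) f S" for v w f S
    using ab by (simp add: E_def wedge_anticommute abelian_def)
  have prod: "free_action E (gen_prod x s) (\<delta> {}) = \<delta> (set s)"
    if "sorted_wrt (<) s" "set s \<subseteq> {1..n}" for s
    using that
  proof (induction s)
    case Nil
    show ?case using free_action_const[of E 1] by simp
  next
    case (Cons i s)
    have "free_action E (gen_prod x (i # s)) (\<delta> {}) = E (x i) (\<delta> (set s))"
      using Cons by (simp add: free_action_mult[OF E] free_action_gen)
    also have "\<dots> = \<delta> (insert i (set s))"
      using Cons.prems by (simp add: E_def \<delta>_def coord_basis wedge_unit)
    finally show ?case by simp
  qed
  have sum: "free_action E (sum h A) f S = (\<Sum>s\<in>A. free_action E (h s) f S)" for h :: "nat list \<Rightarrow> _" and A f S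
    by (induction A rule: infinite_finite_induct) (simp_all add: free_action_add, simp_all add: free_action_def)
  have "0 = free_action E (\<Sum>s\<in>?S. const (c s) * gen_prod x s) (\<delta> {}) (set t)"
    using enveloping_kernel_acts_trivially[OF E E_add E_scale E_mul c] by simp
  also have "\<dots> = (\<Sum>s\<in>?S. c s * \<delta> (set s) (set t))"
    unfolding sum
    by (intro sum.cong refl) (simp add: free_action_mult[OF E] free_action_const prod increasing_sequences_def)
  also have "\<dots> = (\<Sum>s\<in>?S. if s = t then c s else 0)"
  proof (intro sum.cong refl)
    fix s assume "s \<in> ?S"
    then have "set s = set t \<longleftrightarrow> s = t"
      using t by (auto simp: increasing_sequences_def intro: strict_sorted_equal)
    then show "c s * \<delta> (set s) (set t) = (if s = t then c s else 0)"
      by (auto simp: \<delta>_def)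
  qed
  also have "\<dots> = c t"
    using t by (simp add: finite_increasing_sequences)
  finally show ?thesis by simp
qed

end

section \<open>The Poincare-Birkhoff-Witt property characterises abelian algebras\<close>

theorem theorem1:
  fixes scale :: "'k::field \<Rightarrow> 'l::ab_group_add \<Rightarrow> 'l"
    and mul :: "'l \<Rightarrow> 'l \<Rightarrow> 'l"
    and x :: "nat \<Rightarrow> 'l"
    and n :: nat
  assumes "CHAR('k) \<noteq> 2" and "CHAR('k) \<noteq> 3"
    and "mock_lie_algebra scale mul"
    and "inj_on x {1..n}"
    and "\<not> Modules.module.dependent scale (x ` {1..n})"
    and "Modules.module.span scale (x ` {1..n}) = UNIV"
  shows "(inj_on (pbw_monomial scale mul x) (increasing_sequences n) \<and>
      vectorspace.basis ring_of_type_algebra (enveloping_algebra scale mul)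
        (pbw_monomial scale mul x ` increasing_sequences n))
    \<longleftrightarrow> abelian mul"
proof -
  interpret mock_lie_algebra scale mul by fact
  define B where "B = x ` {1..n}"
  let ?S = "increasing_sequences n"
  have two: "(2 :: 'k) \<noteq> 0" and three: "(3 :: 'k) \<noteq> 0"
    using of_nat_prime_neq_0[of 2, where 'k = 'k] of_nat_prime_neq_0[of 3, where 'k = 'k] assms(1,2)
    by simp_all
  have indep: "independent B" and span: "v \<in> span B" for v
    using assms(5,6) by (auto simp: B_def)
  \<comment> \<open>Outside \<open>{1..n}\<close> the values of \<open>x\<close> are arbitrary and may repeat basis vectors, hence the default 0.\<close>
  define coord where "coord v i = (if i \<in> {1..n} then representation B v (x i) else 0)" for v i
  have coord_add: "coord (v + w) i = coord v i + coord w i" for v w i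
    by (simp add: coord_def representation_add[OF indep span span])
  have coord_scale: "coord (scale c v) i = c * coord v i" for c v i
    by (simp add: coord_def representation_scale[OF indep span])
  have coord_basis: "coord (x j) = (\<lambda>i. if i = j then 1 else 0)" if "j \<in> {1..n}" for j
  proof
    fix i
    have "x j \<in> B" using that by (simp add: B_def)
    then show "coord (x j) i = (if i = j then 1 else 0)"
      using that inj_onD[OF assms(4), of i j]
      by (auto simp: coord_def representation_basis[OF indep])
  qed
  have gens: "\<exists>a. v = (\<Sum>i\<in>{1..n}. scale (a i) (x i))" for v
  proof -
    have "finite B" by (simp add: B_def)
    then have "v = (\<Sum>b\<in>B. scale (representation B v b) b)"
      using sum_representation_eq[OF indep span] by simp
    also have "\<dots> = (\<Sum>i\<in>{1..n}. scale (representation B v (x i)) (x i))"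
      unfolding B_def by (simp only: sum.reindex[OF assms(4)] o_def)
    finally show ?thesis by (rule exI[of _ "\<lambda>i. representation B v (x i)"])
  qed
  have pbw: "(inj_on (pbw_monomial scale mul x) ?S \<and>
      vectorspace.basis ring_of_type_algebra (enveloping_algebra scale mul) (pbw_monomial scale mul x ` ?S)) \<longleftrightarrow>
    (\<forall>p. \<exists>c. p \<doteq> (\<Sum>s\<in>?S. const (c s) * gen_prod x s)) \<and>
    (\<forall>c. (\<Sum>s\<in>?S. const (c s) * gen_prod x s) \<in> enveloping_kernel scale mul \<longrightarrow> (\<forall>s\<in>?S. c s = 0))"
    unfolding pbw_monomial_eq[abs_def] env_cong_def by (rule basis_image_iff[OF finite_increasing_sequences])
  show ?thesis
  proof
    assume "inj_on (pbw_monomial scale mul x) ?S \<and>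
      vectorspace.basis ring_of_type_algebra (enveloping_algebra scale mul) (pbw_monomial scale mul x ` ?S)"
    then have coeffs_zero: "\<forall>s\<in>?S. c s = 0"
      if "(\<Sum>s\<in>?S. const (c s) * gen_prod x s) \<in> enveloping_kernel scale mul" for c
      using that pbw by blast
    show "abelian mul"
    proof (rule abelian_if_squares_proportional[OF two three])
      fix v :: 'l assume "v \<noteq> 0"
      show "\<exists>c. mul v v = scale c v"
        by (rule square_proportional[OF two three gens _ \<open>v \<noteq> 0\<close>]) (rule coeffs_zero)
    qed
  next
    assume ab: "abelian mul"
    have "\<exists>c. p \<doteq> (\<Sum>s\<in>?S. const (c s) * gen_prod x s)" for p
      by (rule increasing_products_span[OF two ab gens])
    moreover have "c t = 0"
      if "(\<Sum>s\<in>?S. const (c s) * gen_prod x s) \<in> enveloping_kernel scale mul" "t \<in> ?S" for c t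
      by (rule increasing_products_independent[OF ab coord_add coord_scale _ that]) (rule coord_basis)
    ultimately show "inj_on (pbw_monomial scale mul x) ?S \<and>
      vectorspace.basis ring_of_type_algebra (enveloping_algebra scale mul) (pbw_monomial scale mul x ` ?S)"
      unfolding pbw by blast
  qed
qed

end
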